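(* Let $s,t\ge 1$, $n>s+t$ and $N=n+2s+t$. Let $\alpha_{1,3}(s,t,n)$ be the number of continuous multiline queues of type $(s,t,n-s-t)$ with the largest entry $N$ in the last row and no wrapping from the second row to the third row, whose projected word $\omega$ has $\omega_1=1$ and $\omega_2=3$. Then $$\alpha_{1,3}(s,t,n)=\left(\binom{N-2}{s-1}-\binom{N-2}{s-3}\right)f_{(n-1,s+t)}.$$
   Context: A continuous multiline queue of type $(s,t,n-s-t)$ is a three-row array whose rows are strictly increasing sequences $a_1<\cdots<a_s$, $b_1<\cdots<b_{s+t}$, $c_1<\cdots<c_n$, whose $N$ entries are exactly $1,\ldots,N$, each once. Bully path procedure: initially all entries are available. First, each entry of row 1 starts a bully path; then each still-available entry of row 2 starts a bully path. An entry $x$ on a path bullies the smallest available entry of the next row larger than $x$, or, if there is none, the smallest available entry of the next row (a wrapping from that row to the next); bullied entries become unavailable and the path continues to row 3. Endpoints of paths starting in row 1 get label 1, those starting in row 2 get label 2, remaining entries of row 3 get label 3. The projected word is $\omega=(\omega_1,\ldots,\omega_n)$, $\omega_k$ the label of $c_k$. $f_{(a,b)}$ is the number of standard Young tableaux of shape $(a,b)$, equal to $\frac{a-b+1}{a+1}\binom{a+b}{a}$ for $a\ge b\ge0$. Binomial coefficients $\binom{x}{k}$ with $k<0$ are $0$. *)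

theory Defs
  imports Complex_Main
begin

type_synonym mlq = "nat list \<times> nat list \<times> nat list"

definition cmlqs :: "nat \<Rightarrow> nat \<Rightarrow> nat \<Rightarrow> mlq set" where
  "cmlqs m1 m2 m3 = {(a, b, c).
     length a = m1 \<and> length b = m1 + m2 \<and> length c = m1 + m2 + m3 \<and>
     sorted_wrt (<) a \<and> sorted_wrt (<) b \<and> sorted_wrt (<) c \<and>
     distinct (a @ b @ c) \<and>
     set (a @ b @ c) = {1..length a + length b + length c}}"

text \<open>In the following, \<open>A\<close> is the set of available entries of the next row.\<close>

definition wraps :: "nat \<Rightarrow> nat set \<Rightarrow> bool" where
  "wraps x A \<longleftrightarrow> \<not> (\<exists>y\<in>A. x < y)"

definition bullied :: "nat \<Rightarrow> nat set \<Rightarrow> nat" where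
  "bullied x A = (if wraps x A then Min A else Min {y \<in> A. x < y})"

text \<open>Paths starting in row 1, run one after the other from left to right, where \<open>B\<close> and \<open>C\<close>
  are the available entries of rows 2 and 3.  Each path is recorded as its entry in row 2, its
  endpoint in row 3, and whether its step from row 2 to row 3 is a wrapping.  The order in which
  the paths of one row are run affects neither the labels nor the occurrence of wrappings.\<close>

fun row1_paths :: "nat list \<Rightarrow> nat set \<Rightarrow> nat set \<Rightarrow> (nat \<times> nat \<times> bool) list" where
  "row1_paths [] B C = []"
| "row1_paths (x # xs) B C =
     (let y = bullied x B; z = bullied y C
      in (y, z, wraps y C) # row1_paths xs (B - {y}) (C - {z}))"

fun row2_paths :: "nat list \<Rightarrow> nat set \<Rightarrow> (nat \<times> nat \<times> bool) list" where
  "row2_paths [] C = []"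
| "row2_paths (y # ys) C =
     (let z = bullied y C in (y, z, wraps y C) # row2_paths ys (C - {z}))"

definition row2_entries :: "(nat \<times> nat \<times> bool) list \<Rightarrow> nat set" where
  "row2_entries ps = {y. \<exists>z w. (y, z, w) \<in> set ps}"

definition endpoints :: "(nat \<times> nat \<times> bool) list \<Rightarrow> nat set" where
  "endpoints ps = {z. \<exists>y w. (y, z, w) \<in> set ps}"

fun class1_paths :: "mlq \<Rightarrow> (nat \<times> nat \<times> bool) list" where
  "class1_paths (a, b, c) = row1_paths a (set b) (set c)"

fun class2_paths :: "mlq \<Rightarrow> (nat \<times> nat \<times> bool) list" where
  "class2_paths (a, b, c) =
     (let ps = class1_paths (a, b, c)
      in row2_paths (filter (\<lambda>y. y \<notin> row2_entries ps) b) (set c - endpoints ps))"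

definition no_wrapping_23 :: "mlq \<Rightarrow> bool" where
  "no_wrapping_23 q \<longleftrightarrow>
     (\<forall>(y, z, w) \<in> set (class1_paths q) \<union> set (class2_paths q). \<not> w)"

definition label :: "mlq \<Rightarrow> nat \<Rightarrow> nat" where
  "label q z = (if z \<in> endpoints (class1_paths q) then 1
                else if z \<in> endpoints (class2_paths q) then 2 else 3)"

fun projected_word :: "mlq \<Rightarrow> nat list" where
  "projected_word (a, b, c) = map (label (a, b, c)) c"

fun last_row :: "mlq \<Rightarrow> nat list" where
  "last_row (a, b, c) = c"

definition alpha13 :: "nat \<Rightarrow> nat \<Rightarrow> nat \<Rightarrow> nat" where
  "alpha13 s t n = card {q \<in> cmlqs s t (n - s - t).
     n + 2 * s + t \<in> set (last_row q) \<and> no_wrapping_23 q \<and>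
     projected_word q ! 0 = 1 \<and> projected_word q ! 1 = 3}"

text \<open>Standard Young tableaux of the two-row shape \<open>(a, b)\<close>, \<open>a \<ge> b\<close>, as pairs of rows.\<close>

definition syt2 :: "nat \<Rightarrow> nat \<Rightarrow> (nat list \<times> nat list) set" where
  "syt2 a b = {(u, v). length u = a \<and> length v = b \<and>
     sorted_wrt (<) u \<and> sorted_wrt (<) v \<and> (\<forall>i<b. u ! i < v ! i) \<and>
     distinct (u @ v) \<and> set (u @ v) = {1..a + b}}"

definition num_syt2 :: "nat \<Rightarrow> nat \<Rightarrow> nat" where
  "num_syt2 a b = card (syt2 a b)"

definition binom :: "nat \<Rightarrow> int \<Rightarrow> int" where
  "binom x k = (if k < 0 then 0 else int (x choose nat k))"

end

theory Submission
  imports Defs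
begin

text \<open>Encode a queue as the word whose \<open>i\<close>-th letter is the row of the entry \<open>i\<close>. By Hall's
  condition there is no wrapping from row 2 to row 3 iff every suffix has at least as many letters 3 as 2.
  Then \<open>\<omega>\<^sub>1 = 1\<close> and \<open>\<omega>\<^sub>2 = 3\<close> say that the letters 2 and 3 form a word \<open>2 3 3 v\<close> and that the first
  entry of row 2 is bullied from row 1. Without the latter condition the letters 1 can be inserted
  freely before the final 3, which gives a binomial coefficient times a number of two-row
  tableaux. The latter condition fails iff the word is \<open>2 w'\<close> and every suffix of \<open>w'\<close> also has at
  least as many letters 2 as 1; such \<open>w'\<close> are three-row tableaux whose last two entries outside the
  third row lie in the first row, and they are counted by summing the hook length formula twice.\<close>

section \<open>Bully paths and Hall's condition\<close>

text \<open>The subtracted count is no product, yet the answer is. The \<open>s\<close> letters 1 go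
  before the final 3 of \<open>2 3 3 v\<close> in the free count, and anywhere into
  \<open>3 3 v\<close> in the subtracted one, there subject to \<open>ballot 1 2\<close>. Without
  that condition both have the same number of insertions: \<open>3 3 v\<close> has one letter less,
  but the place after its last letter is open as well. So the answer counts the insertions into
  \<open>3 3 v\<close> that violate \<open>ballot 1 2\<close>, and this single term is the product
  in the theorem. The obstacle before that is that labels come from paths run in a prescribed order,
  with wrapping allowed from row 1 to row 2. All steps from one row to the next are therefore
  treated as one greedy matching. Hall's condition does not see the order, and row 1 matters only
  through whether the smallest entry of row 2 is bullied.\<close>

text \<open>Hall's condition for matching each entry of \<open>ys\<close> with a larger entry of \<open>C\<close>.\<close>

definition dominated :: "nat list \<Rightarrow> nat set \<Rightarrow> bool" where
  "dominated ys C \<longleftrightarrow> (\<forall>x. length (filter (\<lambda>y. x \<le> y) ys) \<le> card {z \<in> C. x \<le> z})"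

text \<open>Row 2 entries bullied from row 1 move on first, so row 2 is not processed in sorted
  order. As Hall's condition ignores order, it can still be stated for the sorted row
  \<open>b\<close>.\<close>

lemma dominated_cong_set:
  assumes "distinct xs" "distinct ys" "set xs = set ys"
  shows "dominated xs C \<longleftrightarrow> dominated ys C"
proof -
  have "length (filter P xs) = length (filter P ys)" for P
    using assms by (simp flip: distinct_card)
  then show ?thesis unfolding dominated_def by simp
qed

lemma card_ge_remove:
  fixes C :: "nat set"
  assumes "finite C" "z \<in> C"
  shows "card {u \<in> C. x \<le> u} = card {u \<in> C - {z}. x \<le> u} + (if x \<le> z then 1 else 0)"
proof -
  have e: "{u \<in> C - {z}. x \<le> u} = {u \<in> C. x \<le> u} - {z}" by auto
  show ?thesis
  proof (cases "x \<le> z")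
    case True
    then show ?thesis unfolding e
      using assms by (subst card.remove[of _ z]) auto
  next
    case False
    then have "{u \<in> C. x \<le> u} - {z} = {u \<in> C. x \<le> u}" by auto
    with False show ?thesis unfolding e by simp
  qed
qed

text \<open>An exchange argument: matching \<open>y\<close> with the smallest larger element never
  spoils a matching. Hall's condition uses \<open>\<le>\<close> and bullying uses \<open><\<close>;
  since \<open>y\<close> is not in \<open>C\<close>, they agree at \<open>y\<close>.\<close>

lemma dominated_Cons:
  assumes fin: "finite C" and y: "y \<notin> C"
  shows "dominated (y # ys) C \<longleftrightarrow>
    (\<exists>z\<in>C. y < z) \<and> dominated ys (C - {Min {z \<in> C. y < z}})"
proof -
  let ?z = "Min {z \<in> C. y < z}"
  have gt: "\<exists>z\<in>C. y < z" if "dominated (y # ys) C"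
  proof -
    have "card {z \<in> C. y \<le> z} \<ge> 1"
      using that unfolding dominated_def by (auto dest!: spec[of _ y])
    then have "{z \<in> C. y \<le> z} \<noteq> {}" by (metis card.empty not_one_le_zero)
    then show ?thesis using y by (metis (mono_tags, lifting) empty_Collect_eq le_neq_implies_less)
  qed
  have "dominated (y # ys) C \<longleftrightarrow> dominated ys (C - {?z})" if ex: "\<exists>z\<in>C. y < z"
  proof -
    have "?z \<in> {z \<in> C. y < z}" using fin ex by (intro Min_in) auto
    then have z: "?z \<in> C" "y < ?z" by auto
    have zmin: "?z \<le> u" if "u \<in> C" "y < u" for u
      using fin that by (intro Min_le) auto
    note rem = card_ge_remove[OF fin z(1)]
    show ?thesis
    proof
      assume D: "dominated (y # ys) C"
      show "dominated ys (C - {?z})" unfolding dominated_def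
      proof
        fix x
        show "length (filter ((\<le>) x) ys) \<le> card {u \<in> C - {?z}. x \<le> u}"
        \<comment> \<open>Only these thresholds count the removed element of \<open>C\<close> but
          not \<open>y\<close>. No element of \<open>C\<close> lies strictly between
          \<open>y\<close> and \<open>?z\<close>, so the condition at \<open>y\<close> gives the one
          at \<open>x\<close>.\<close>
        proof (cases "y < x \<and> x \<le> ?z")
          case True
          have "{u \<in> C - {?z}. x \<le> u} = {u \<in> C - {?z}. y \<le> u}"
          proof (intro Collect_cong conj_cong refl)
            fix u assume "u \<in> C - {?z}"
            then have "u \<noteq> y" "y < u \<Longrightarrow> ?z \<le> u" using y zmin by auto
            then show "x \<le> u \<longleftrightarrow> y \<le> u" using True by linarith
          qed
          moreover have "length (filter ((\<le>) x) ys) \<le> length (filter ((\<le>) y) ys)"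
            using True by (induction ys) auto
          moreover have "length (filter ((\<le>) y) ys) \<le> card {u \<in> C - {?z}. y \<le> u}"
            using D[unfolded dominated_def, rule_format, of y] z rem[of y] by simp
          ultimately show ?thesis by simp
        next
          case False
          then show ?thesis
            using D[unfolded dominated_def, rule_format, of x] z rem[of x]
            by (simp split: if_splits)
        qed
      qed
    next
      assume D: "dominated ys (C - {?z})"
      show "dominated (y # ys) C" unfolding dominated_def
      proof
        fix x
        show "length (filter ((\<le>) x) (y # ys)) \<le> card {u \<in> C. x \<le> u}"
          using D[unfolded dominated_def, rule_format, of x] z rem[of x]
          by (simp split: if_splits)
      qed
    qed
  qed
  with gt show ?thesis by blast
qed

section \<open>Bully paths as greedy matchings\<close>

lemma map_fst_row2_paths [simp]: "map fst (row2_paths ys C) = ys"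
  by (induction ys C rule: row2_paths.induct) (auto simp: Let_def)

lemma row2_paths_append:
  "row2_paths (xs @ ys) C = row2_paths xs C @ row2_paths ys (C - endpoints (row2_paths xs C))"
proof (induction xs C rule: row2_paths.induct)
  case (2 y ys' C)
  have "endpoints ((a, b, c) # ps) = insert b (endpoints ps)" for a b c ps
    by (auto simp: endpoints_def)
  then show ?case using 2 by (simp add: Let_def) (metis Diff_insert insert_Diff_single Diff_insert2)
qed (auto simp: endpoints_def)

text \<open>\<open>row1_paths\<close> interleaves two steps. This lemma and the next separate them:
  the steps into row 3 are a \<open>row2_paths\<close> run from the bullied entries of row 2, and
  the steps into row 2 are a \<open>row2_paths\<close> run from row 1. Only one function is left to
  analyse.\<close>

lemma row1_paths_eq_row2_paths:
  "row1_paths xs B C = row2_paths (map fst (row1_paths xs B C)) C"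
  by (induction xs B C rule: row1_paths.induct) (auto simp: Let_def)

lemma map_fst_row1_paths: "map fst (row1_paths xs B C) = map (fst \<circ> snd) (row2_paths xs B)"
  by (induction xs B C rule: row1_paths.induct) (auto simp: Let_def)

lemma endpoints_eq: "endpoints ps = set (map (fst \<circ> snd) ps)"
  unfolding endpoints_def by force

lemma row2_entries_eq: "row2_entries ps = set (map fst ps)"
  unfolding row2_entries_def by force

lemma bullied_in: "finite C \<Longrightarrow> C \<noteq> {} \<Longrightarrow> bullied y C \<in> C"
  using Min_in[of C] Min_in[of "{z \<in> C. y < z}"]
  by (auto simp: bullied_def wraps_def)

text \<open>Wrapping is allowed here, since it may occur from row 1 to row 2. The cardinality bound
  keeps the available set nonempty, so each step picks an available entry.\<close>

lemma row2_paths_endpoints: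
  assumes "finite C" "length ys \<le> card C"
  shows "distinct (map (fst \<circ> snd) (row2_paths ys C)) \<and>
    set (map (fst \<circ> snd) (row2_paths ys C)) \<subseteq> C"
  using assms
proof (induction ys C rule: row2_paths.induct)
  case (2 y ys C)
  let ?z = "bullied y C"
  have z: "?z \<in> C" using 2(2,3) by (intro bullied_in) auto
  then have "length ys \<le> card (C - {?z})" using 2(2,3) by auto
  then show ?case using 2(1)[OF refl] 2(2) z by (auto simp: Let_def)
qed auto

lemma row2_paths_nowrap_iff:
  assumes "finite C" "set ys \<inter> C = {}"
  shows "(\<forall>(y, z, w) \<in> set (row2_paths ys C). \<not> w) \<longleftrightarrow> dominated ys C"
  using assms
proof (induction ys C rule: row2_paths.induct)
  case (1 C)
  then show ?case by (simp add: dominated_def)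
next
  case (2 y ys C)
  have "set ys \<inter> (C - {bullied y C}) = {}" using 2(3) by auto
  note IH = 2(1)[OF refl _ this]
  show ?case
    using IH 2(2,3) dominated_Cons[of C y ys]
    by (auto simp: Let_def wraps_def bullied_def)
qed

lemma row2_paths_nowrap:
  assumes "finite C" "set ys \<inter> C = {}" "dominated ys C" "(y, z, w) \<in> set (row2_paths ys C)"
  shows "y < z \<and> z \<in> C \<and> (\<forall>e\<in>C. e \<notin> endpoints (row2_paths ys C) \<and> y < e \<longrightarrow> z < e)"
  using assms
proof (induction ys C rule: row2_paths.induct)
  case (2 y' ys C)
  let ?z = "Min {z \<in> C. y' < z}"
  from 2(3,4) 2(2) have D: "\<exists>z\<in>C. y' < z" "dominated ys (C - {?z})"
    using dominated_Cons[of C y' ys] by auto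
  then have b: "bullied y' C = ?z" by (auto simp: bullied_def wraps_def)
  have z: "?z \<in> {z \<in> C. y' < z}" using 2(2) D(1) by (intro Min_in) auto
  have ep: "endpoints (row2_paths (y' # ys) C) = insert ?z (endpoints (row2_paths ys (C - {?z})))"
    by (simp add: Let_def b endpoints_eq)
  have min: "?z \<le> e" if "e \<in> C" "y' < e" for e
    using 2(2) that by (intro Min_le) auto
  have dis: "set ys \<inter> (C - {bullied y' C}) = {}" using 2(3) by auto
  consider "y = y'" "z = ?z" | "(y, z, w) \<in> set (row2_paths ys (C - {?z}))"
    using 2(5) by (auto simp: Let_def b)
  then show ?case
  proof cases
    case 1
    then show ?thesis using z min unfolding ep by (auto simp: order_le_less)
  next
    case 2
    then show ?thesis
      using "2.IH"[OF refl _ dis] D(2) \<open>finite C\<close> unfolding ep b by auto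
  qed
qed auto

text \<open>A wrapping, or an entry below the minimum of \<open>B\<close>, would bully this minimum.\<close>

lemma Min_notin_endpoints_iff:
  assumes "finite B" "set xs \<inter> B = {}" "m \<in> B" "\<And>y. y \<in> B \<Longrightarrow> m \<le> y"
  shows "m \<notin> endpoints (row2_paths xs B) \<longleftrightarrow>
    (\<forall>x\<in>set xs. m < x) \<and> dominated xs (B - {m})"
  using assms
proof (induction xs B rule: row2_paths.induct)
  case (1 C)
  then show ?case by (simp add: dominated_def endpoints_def)
next
  case (2 x xs B)
  let ?z = "bullied x B"
  have ep: "endpoints (row2_paths (x # xs) B) = insert ?z (endpoints (row2_paths xs (B - {?z})))"
    by (simp add: Let_def endpoints_eq)
  have minB: "Min B = m" using 2(2,4,5) by (intro Min_eqI) auto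
  have "?z \<noteq> m \<longleftrightarrow> m < x \<and> (\<exists>z\<in>B - {m}. x < z)"
  proof
    assume nz: "?z \<noteq> m"
    then have ex: "\<exists>z\<in>B. x < z" using minB unfolding bullied_def wraps_def by metis
    have "\<not> x < m"
    proof
      assume "x < m"
      then have "{y \<in> B. x < y} = B" using 2(5) less_le_trans by blast
      with nz ex minB show False by (auto simp: bullied_def wraps_def)
    qed
    moreover have "x \<noteq> m" using 2(3,4) by auto
    ultimately show "m < x \<and> (\<exists>z\<in>B - {m}. x < z)" using ex by auto
  next
    assume r: "m < x \<and> (\<exists>z\<in>B - {m}. x < z)"
    then have "?z = Min {y \<in> B. x < y}" by (auto simp: bullied_def wraps_def)
    moreover have "Min {y \<in> B. x < y} \<in> {y \<in> B. x < y}"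
      using r 2(2) by (intro Min_in) auto
    ultimately show "?z \<noteq> m" using r by auto
  qed
  moreover have "m \<notin> endpoints (row2_paths xs (B - {?z})) \<longleftrightarrow>
      (\<forall>x\<in>set xs. m < x) \<and> dominated xs (B - {m} - {Min {y \<in> B - {m}. x < y}})"
    if r: "?z \<noteq> m" "m < x" "\<exists>z\<in>B - {m}. x < z"
  proof -
    have "{y \<in> B - {m}. x < y} = {y \<in> B. x < y}" using r(2) by auto
    then have "Min {y \<in> B - {m}. x < y} = ?z" using r by (auto simp: bullied_def wraps_def)
    moreover have "B - {m} - {?z} = B - {?z} - {m}" by auto
    ultimately show ?thesis using 2 r by auto
  qed
  moreover have "dominated (x # xs) (B - {m}) \<longleftrightarrow>
     (\<exists>z\<in>B - {m}. x < z) \<and> dominated xs (B - {m} - {Min {y \<in> B - {m}. x < y}})"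
    using 2(2,3) by (intro dominated_Cons) auto
  ultimately show ?case unfolding ep by auto
qed

lemma first_two_endpoints_iff:
  assumes "finite C" "set ys \<inter> C = {}" "dominated ys C" "distinct ys" "length ys \<le> card C"
    and C: "c1 \<in> C" "c2 \<in> C" "c1 < c2" "\<And>z. z \<in> C \<Longrightarrow> z = c1 \<or> c2 \<le> z"
  defines "P \<equiv> row2_paths ys C"
  shows "(\<exists>w. (y, c1, w) \<in> set P) \<and> c2 \<notin> endpoints P \<longleftrightarrow>
    y \<in> set ys \<and> y < c1 \<and> (\<forall>y'\<in>set ys. y' \<noteq> y \<longrightarrow> c2 < y')"
proof -
  note nw = row2_paths_nowrap[OF assms(1-3), folded P_def]
  have fsts: "map fst P = ys" unfolding P_def by simp
  then have dy: "distinct (map fst P)" using assms(4) by simp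
  have dz: "distinct (map (fst \<circ> snd) P)"
    using row2_paths_endpoints[OF assms(1,5)] unfolding P_def by simp
  have path: "\<exists>z w. (y, z, w) \<in> set P" if "y \<in> set ys" for y
  proof -
    have "y \<in> fst ` set P" using that fsts by (metis list.set_map)
    then show ?thesis by force
  qed
  have start: "y \<in> set ys" if "(y, z, w) \<in> set P" for y z w
    using that fsts by (metis fst_conv image_eqI list.set_map)
  have uy: "z = z'" if "(y, z, w) \<in> set P" "(y, z', w') \<in> set P" for y z w z' w'
    using eq_key_imp_eq_value[OF dy that] by simp
  have uz: "y = y'" if "(y, z, w) \<in> set P" "(y', z, w') \<in> set P" for y z w y' w'
    using that dz by (metis comp_apply distinct_map fst_conv inj_onD snd_conv)
  show ?thesis
  proof
    assume L: "(\<exists>w. (y, c1, w) \<in> set P) \<and> c2 \<notin> endpoints P"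
    then obtain w where w: "(y, c1, w) \<in> set P" by blast
    have "c2 < y'" if y': "y' \<in> set ys" "y' \<noteq> y" for y'
    proof (rule ccontr)
      assume "\<not> c2 < y'"
      moreover have "y' \<noteq> c2" using y'(1) C(2) assms(2) by auto
      ultimately have lt: "y' < c2" by simp
      obtain z w' where p: "(y', z, w') \<in> set P" using path y'(1) by blast
      then have "z < c2" "z \<in> C" using nw[OF p] L C(2) lt by auto
      then have "z = c1" using C(4) by fastforce
      then show False using uz p w y'(2) by blast
    qed
    then show "y \<in> set ys \<and> y < c1 \<and> (\<forall>y'\<in>set ys. y' \<noteq> y \<longrightarrow> c2 < y')"
      using start[OF w] nw[OF w] by blast
  next
    assume R: "y \<in> set ys \<and> y < c1 \<and> (\<forall>y'\<in>set ys. y' \<noteq> y \<longrightarrow> c2 < y')"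
    have low: "y' = y" if p: "(y', z, w) \<in> set P" and "z \<le> c2" for y' z w
      using R start[OF p] nw[OF p] \<open>z \<le> c2\<close> by (meson leD less_trans)
    obtain z w where p: "(y, z, w) \<in> set P" using R path by blast
    have "c1 \<in> endpoints P"
    proof (rule ccontr)
      assume "c1 \<notin> endpoints P"
      then have "z < c1" "z \<in> C" using nw[OF p] R C(1) by auto
      then show False using C(3,4) by fastforce
    qed
    then obtain y' w' where p': "(y', c1, w') \<in> set P" by (auto simp: endpoints_def)
    then have y: "(y, c1, w') \<in> set P" using low C(3) by fastforce
    have "c2 \<notin> endpoints P"
    proof
      assume "c2 \<in> endpoints P"
      then obtain y'' w'' where p'': "(y'', c2, w'') \<in> set P" by (auto simp: endpoints_def)
      then have "(y, c2, w'') \<in> set P" using low by fastforce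
      then show False using uy[OF y] C(3) by blast
    qed
    then show "(\<exists>w. (y, c1, w) \<in> set P) \<and> c2 \<notin> endpoints P" using y by blast
  qed
qed

lemma cmlq_conditions_iff:
  assumes q: "(a, b, c) \<in> cmlqs s t k" and pos: "s \<ge> 1" "t \<ge> 1" "k \<ge> 1"
  shows "no_wrapping_23 (a, b, c) \<and> projected_word (a, b, c) ! 0 = 1
      \<and> projected_word (a, b, c) ! 1 = 3 \<longleftrightarrow>
    dominated b (set c) \<and> hd b < c ! 0 \<and> (\<forall>y\<in>set (tl b). c ! 1 < y) \<and>
    \<not> ((\<forall>x\<in>set a. hd b < x) \<and> dominated a (set (tl b)))"
    (is "?L \<longleftrightarrow> ?R")
proof -
  from q have len: "length a = s" "length b = s + t" "length c = s + t + k"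
    and sorted: "sorted_wrt (<) a" "sorted_wrt (<) b" "sorted_wrt (<) c"
    and dist: "distinct a" "distinct b" "distinct c"
    and disj: "set a \<inter> set b = {}" "set b \<inter> set c = {}"
    unfolding cmlqs_def by auto
  define P1 where "P1 = class1_paths (a, b, c)"
  define P2 where "P2 = class2_paths (a, b, c)"
  \<comment> \<open>The order in which row 2 moves on to row 3: entries bullied from row 1 first. It
    rearranges \<open>b\<close>, and the paths of both classes become one run.\<close>
  define ys where "ys = map fst P1 @ filter (\<lambda>y. y \<notin> row2_entries P1) b"
  have P1: "P1 = row2_paths (map fst P1) (set c)"
    unfolding P1_def class1_paths.simps by (rule row1_paths_eq_row2_paths)
  have P: "P1 @ P2 = row2_paths ys (set c)"
    unfolding ys_def row2_paths_append P1[symmetric]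
    by (simp add: P2_def P1_def Let_def)
  have fst1: "map fst P1 = map (fst \<circ> snd) (row2_paths a (set b))"
    unfolding P1_def class1_paths.simps by (rule map_fst_row1_paths)
  have "distinct (map fst P1) \<and> set (map fst P1) \<subseteq> set b"
    unfolding fst1 using len dist by (intro row2_paths_endpoints) (auto simp: distinct_card)
  then have ys: "distinct ys" "set ys = set b"
    using dist unfolding ys_def row2_entries_eq by auto
  have dom: "dominated ys (set c) \<longleftrightarrow> dominated b (set c)"
    using ys dist by (intro dominated_cong_set) auto
  have "no_wrapping_23 (a, b, c) \<longleftrightarrow> (\<forall>(y, z, w) \<in> set (P1 @ P2). \<not> w)"
    unfolding no_wrapping_23_def P1_def P2_def by simp
  also have "\<dots> \<longleftrightarrow> dominated b (set c)"
    unfolding P dom[symmetric] using ys disj by (intro row2_paths_nowrap_iff) auto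
  finally have nw: "no_wrapping_23 (a, b, c) \<longleftrightarrow> dominated b (set c)" .
  obtain b1 b' where b: "b = b1 # b'" using len pos by (cases b) auto
  have b1: "\<And>y. y \<in> set b' \<Longrightarrow> b1 < y" "b1 \<notin> set b'" using sorted(2) dist unfolding b by auto
  obtain c1 c2 c' where c: "c = c1 # c2 # c'" using len pos by (cases c; cases "tl c") auto
  have cs: "c1 < c2" "\<And>z. z \<in> set c \<Longrightarrow> z = c1 \<or> c2 \<le> z"
    using sorted(3) unfolding c by auto
  have w1: "projected_word (a, b, c) ! 0 = 1 \<longleftrightarrow> c1 \<in> endpoints P1"
    unfolding c P1_def by (simp add: label_def)
  have w2: "projected_word (a, b, c) ! 1 = 3 \<longleftrightarrow> c2 \<notin> endpoints (P1 @ P2)"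
    unfolding c P1_def P2_def by (simp add: label_def endpoints_eq)
  have ent: "b1 \<in> row2_entries P1 \<longleftrightarrow> \<not> ((\<forall>x\<in>set a. b1 < x) \<and> dominated a (set b'))"
  proof -
    have "row2_entries P1 = endpoints (row2_paths a (set b))"
      unfolding row2_entries_eq endpoints_eq fst1 ..
    moreover have "set b - {b1} = set b'" using b1 unfolding b by auto
    moreover have "b1 \<le> y" if "y \<in> set b" for y using b1 that unfolding b by fastforce
    ultimately show ?thesis
      using Min_notin_endpoints_iff[of "set b" a b1] disj(1) b by auto
  qed
  have "c1 \<in> endpoints P1 \<and> c2 \<notin> endpoints (P1 @ P2) \<longleftrightarrow>
      b1 < c1 \<and> (\<forall>y\<in>set b'. c2 < y) \<and> b1 \<in> row2_entries P1"
    if D: "dominated b (set c)"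
  proof -
    have key: "(\<exists>w. (y, c1, w) \<in> set (P1 @ P2)) \<and> c2 \<notin> endpoints (P1 @ P2) \<longleftrightarrow>
        y \<in> set b \<and> y < c1 \<and> (\<forall>y'\<in>set b. y' \<noteq> y \<longrightarrow> c2 < y')" for y
    proof -
      have "length ys \<le> card (set c)"
        using ys dist len by (metis distinct_card le_add1)
      then show ?thesis
        unfolding P ys(2)[symmetric] using D ys disj cs dom
        by (intro first_two_endpoints_iff) (auto simp: c)
    qed
    show ?thesis
    proof
      assume L: "c1 \<in> endpoints P1 \<and> c2 \<notin> endpoints (P1 @ P2)"
      then obtain y w where p: "(y, c1, w) \<in> set P1" by (auto simp: endpoints_def)
      then have r: "y \<in> set b" "y < c1" "\<forall>y'\<in>set b. y' \<noteq> y \<longrightarrow> c2 < y'"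
        using key[of y] L by auto
      have "y = b1"
      proof (rule ccontr)
        assume n: "y \<noteq> b1"
        then have "c2 < b1" using r b by auto
        moreover have "b1 < y" using n r(1) b1 unfolding b by auto
        ultimately show False using r(2) cs(1) by auto
      qed
      then show "b1 < c1 \<and> (\<forall>y\<in>set b'. c2 < y) \<and> b1 \<in> row2_entries P1"
        using r p b1 unfolding b by (auto simp: row2_entries_def)
    next
      assume R: "b1 < c1 \<and> (\<forall>y\<in>set b'. c2 < y) \<and> b1 \<in> row2_entries P1"
      then have k: "\<exists>w. (b1, c1, w) \<in> set (P1 @ P2)" "c2 \<notin> endpoints (P1 @ P2)"
        using key[of b1] b by auto
      obtain z w where z: "(b1, z, w) \<in> set P1" using R by (auto simp: row2_entries_def)
      \<comment> \<open>\<open>key\<close> puts a path from \<open>b1\<close> to \<open>c1\<close>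
        somewhere in the whole run. As starts are distinct, it is the one already found in class
        1.\<close>
      have "map fst (P1 @ P2) = ys" unfolding P by simp
      then have "distinct (map fst (P1 @ P2))" using ys by simp
      from eq_key_imp_eq_value[OF this] have "z = c1" using k(1) z by fastforce
      then show "c1 \<in> endpoints P1 \<and> c2 \<notin> endpoints (P1 @ P2)"
        using z k(2) by (auto simp: endpoints_def)
    qed
  qed
  then show ?thesis unfolding nw w1 w2 using ent by (auto simp: b c)
qed

section \<open>Queues as words\<close>

fun positions :: "'a \<Rightarrow> nat \<Rightarrow> 'a list \<Rightarrow> nat list" where
  "positions r k [] = []"
| "positions r k (x # w) = (if x = r then [k] else []) @ positions r (Suc k) w"

text \<open>Ballot sequences are read here from the end of the word, that is, from the largest entry down.\<close>

fun ballot :: "'a \<Rightarrow> 'a \<Rightarrow> 'a list \<Rightarrow> bool" where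
  "ballot x y [] \<longleftrightarrow> True"
| "ballot x y (r # w) \<longleftrightarrow> count_list (r # w) x \<le> count_list (r # w) y \<and> ballot x y w"

lemma ballot_count_le: "ballot x y w \<Longrightarrow> count_list w x \<le> count_list w y"
  by (cases w) auto

lemma ballot_iff_drop: "ballot x y w \<longleftrightarrow> (\<forall>j. count_list (drop j w) x \<le> count_list (drop j w) y)"
proof (induction w)
  case (Cons r w)
  have "(\<forall>j. P j) \<longleftrightarrow> P 0 \<and> (\<forall>j. P (Suc j))" for P :: "nat \<Rightarrow> bool"
    by (metis not0_implies_Suc)
  from this[of "\<lambda>j. count_list (drop j (r # w)) x \<le> count_list (drop j (r # w)) y"] Cons
  show ?case by simp
qed simp

lemma ballot_notin: "x \<notin> set w \<Longrightarrow> ballot x y w"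
  by (induction w) auto

lemma count_filter_neq: "y \<noteq> x \<Longrightarrow> count_list (filter (\<lambda>u. u \<noteq> x) w) y = count_list w y"
  by (induction w) auto

text \<open>A third letter changes neither count, so deleting it only drops a repeated suffix
  condition.\<close>

lemma ballot_filter: "r \<noteq> x \<Longrightarrow> r \<noteq> y \<Longrightarrow> ballot x y (filter (\<lambda>u. u \<noteq> r) w) \<longleftrightarrow> ballot x y w"
proof (induction w)
  case (Cons u w)
  then show ?case using ballot_count_le[of x y w] by (auto simp: count_filter_neq)
qed simp

lemma positions_ge: "i \<in> set (positions r k w) \<Longrightarrow> k \<le> i"
proof (induction w arbitrary: k)
  case (Cons x w)
  show ?case using Cons.prems Cons.IH[of "Suc k"] by (auto split: if_splits)
qed simp

lemma set_positions: "set (positions r k w) = {k + i | i. i < length w \<and> w ! i = r}"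
proof (induction w arbitrary: k)
  case (Cons x w)
  have "{k + i | i. i < length (x # w) \<and> (x # w) ! i = r} =
      (if x = r then {k} else {}) \<union> {Suc k + i | i. i < length w \<and> w ! i = r}"
  proof (intro set_eqI iffI)
    fix z assume "z \<in> {k + i | i. i < length (x # w) \<and> (x # w) ! i = r}"
    then obtain i where "z = k + i" "i < length (x # w)" "(x # w) ! i = r" by blast
    then show "z \<in> (if x = r then {k} else {}) \<union> {Suc k + i | i. i < length w \<and> w ! i = r}"
      by (cases i) auto
  next
    fix z assume "z \<in> (if x = r then {k} else {}) \<union> {Suc k + i | i. i < length w \<and> w ! i = r}"
    then consider "x = r" "z = k" | i where "z = Suc k + i" "i < length w" "w ! i = r"
      by (auto split: if_splits)
    then show "z \<in> {k + i | i. i < length (x # w) \<and> (x # w) ! i = r}"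
    proof cases
      case 1
      then show ?thesis by (intro CollectI exI[of _ 0]) auto
    next
      case 2
      then show ?thesis by (intro CollectI exI[of _ "Suc i"]) auto
    qed
  qed
  then show ?case using Cons by simp
qed simp

lemma sorted_positions: "sorted_wrt (<) (positions r k w)"
proof (induction w arbitrary: k)
  case (Cons x w)
  have "k < i" if "i \<in> set (positions r (Suc k) w)" for i
    using positions_ge[OF that] by simp
  then show ?case using Cons by simp
qed simp

lemma distinct_positions: "distinct (positions r k w)"
  using sorted_positions[of r k w] by (simp add: strict_sorted_iff)

lemma length_positions: "length (positions r k w) = count_list w r"
  by (induction w arbitrary: k) auto

text \<open>Truncated subtraction is intended: a threshold below the offset keeps the whole
  word.\<close>

lemma filter_positions: "length (filter ((\<le>) x) (positions r k w)) = count_list (drop (x - k) w) r"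
proof (induction w arbitrary: k)
  case (Cons u w)
  show ?case
  proof (cases "x \<le> k")
    case True
    then have "filter ((\<le>) x) (positions r k (u # w)) = positions r k (u # w)"
      using positions_ge[of _ r k "u # w"] by (intro filter_True) fastforce
    then show ?thesis using True by (simp only: length_positions) simp
  next
    case False
    then obtain d where "x = Suc (k + d)" by (metis add_Suc_right less_imp_Suc_add not_le)
    then show ?thesis using Cons[of "Suc k"] by simp
  qed
qed simp

text \<open>The entries from \<open>u\<close> on form a suffix of the word, so the thresholds of
  Hall's condition become the suffixes of \<open>ballot\<close>. This is why words are read from the
  end.\<close>

lemma dominated_positions:
  "dominated (positions x k w) (set (positions y k w)) \<longleftrightarrow> ballot x y w"
proof -
  have "card {z \<in> set (positions y k w). u \<le> z} = count_list (drop (u - k) w) y" for u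
  proof -
    have "{z \<in> set (positions y k w). u \<le> z} = set (filter ((\<le>) u) (positions y k w))" by auto
    then show ?thesis
      using distinct_positions[of y k w] filter_positions[of u y k w]
      by (metis distinct_card distinct_filter)
  qed
  then have "dominated (positions x k w) (set (positions y k w)) \<longleftrightarrow>
      (\<forall>u. count_list (drop (u - k) w) x \<le> count_list (drop (u - k) w) y)"
    unfolding dominated_def filter_positions by simp
  also have "\<dots> \<longleftrightarrow> ballot x y w" unfolding ballot_iff_drop by (metis add_diff_cancel_left')
  finally show ?thesis .
qed

section \<open>The bijection between words and queues\<close>

lemma length_eq_counts:
  fixes w :: "nat list"
  assumes "set w \<subseteq> {1, 2, 3}"
  shows "length w = count_list w 1 + count_list w 2 + count_list w 3"
  using assms by (induction w) auto

definition words :: "nat \<Rightarrow> nat \<Rightarrow> nat \<Rightarrow> nat list set" where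
  "words p m s = {w. set w \<subseteq> {1, 2, 3} \<and>
     count_list w 3 = p \<and> count_list w 2 = m \<and> count_list w 1 = s}"

lemma finite_words: "finite (words p m s)"
proof (rule finite_subset)
  show "words p m s \<subseteq> {w. set w \<subseteq> {1, 2, 3} \<and> length w = s + m + p}"
    using length_eq_counts by (auto simp: words_def)
qed (rule finite_lists_length_eq, simp)

definition rows :: "nat list \<Rightarrow> mlq" where
  "rows w = (positions 1 1 w, positions 2 1 w, positions 3 1 w)"

lemma rows_in_cmlqs:
  assumes "w \<in> words (s + t + k) (s + t) s"
  shows "rows w \<in> cmlqs s t k"
proof -
  from assms have w: "set w \<subseteq> {1, 2, 3}" and len: "length w = s + (s + t) + (s + t + k)"
    using length_eq_counts[of w] by (auto simp: words_def)
  have "set (positions 1 1 w) \<union> set (positions 2 1 w) \<union> set (positions 3 1 w) = {1..length w}"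
  proof (intro set_eqI iffI)
    fix i assume i: "i \<in> {1..length w}"
    then have "i - 1 < length w" by auto
    then have "w ! (i - 1) \<in> {1, 2, 3}" using w nth_mem by blast
    moreover have "i = 1 + (i - 1)" using i by simp
    ultimately show "i \<in> set (positions 1 1 w) \<union> set (positions 2 1 w) \<union> set (positions 3 1 w)"
      using \<open>i - 1 < length w\<close> unfolding set_positions by blast
  qed (auto simp: set_positions)
  moreover have "set (positions x 1 w) \<inter> set (positions y 1 w) = {}" if "x \<noteq> y" for x y
    using that by (auto simp: set_positions)
  moreover have "length (positions 1 1 w) = s" "length (positions 2 1 w) = s + t"
      "length (positions 3 1 w) = s + t + k"
    using assms unfolding words_def length_positions by auto
  ultimately show ?thesis
    unfolding rows_def cmlqs_def
    by (simp add: sorted_positions distinct_positions len Un_assoc Int_Un_distrib)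
qed

lemma inj_on_rows: "inj_on rows (words p m s)"
proof (rule inj_onI)
  fix w w' assume ws: "w \<in> words p m s" "w' \<in> words p m s" and eq: "rows w = rows w'"
  have len: "length w = length w'" using ws length_eq_counts by (auto simp: words_def)
  show "w = w'"
  proof (rule nth_equalityI[OF len])
    fix i assume i: "i < length w"
    then have "w ! i \<in> {1, 2, 3}" using ws nth_mem by (fastforce simp: words_def)
    then have "positions (w ! i) 1 w = positions (w ! i) 1 w'"
      using eq unfolding rows_def by auto
    moreover have "1 + i \<in> set (positions (w ! i) 1 w)" unfolding set_positions using i by blast
    ultimately have "1 + i \<in> set (positions (w ! i) 1 w')" by simp
    then show "w ! i = w' ! i" unfolding set_positions by auto
  qed
qed

lemma rows_surj:
  assumes "(a, b, c) \<in> cmlqs s t k"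
  shows "(a, b, c) \<in> rows ` words (s + t + k) (s + t) s"
proof -
  define N where "N = length a + length b + length c"
  from assms have len: "length a = s" "length b = s + t" "length c = s + t + k"
    and sorted: "sorted_wrt (<) a" "sorted_wrt (<) b" "sorted_wrt (<) c"
    and disj: "set a \<inter> set b = {}" "set a \<inter> set c = {}" "set b \<inter> set c = {}"
    and un: "set a \<union> set b \<union> set c = {1..N}"
    unfolding cmlqs_def N_def by auto
  define f :: "nat \<Rightarrow> nat"
    where "f i = (if i \<in> set a then 1 else if i \<in> set b then 2 else 3)" for i
  define w where "w = map f [1..<Suc N]"
  have sp: "set (positions r 1 w) = {i \<in> {1..N}. f i = r}" for r
  proof -
    have "{i \<in> {1..N}. f i = r} = {1 + i | i. i < N \<and> f (1 + i) = r}"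
    proof (intro set_eqI iffI)
      fix i assume "i \<in> {i \<in> {1..N}. f i = r}"
      then show "i \<in> {1 + i | i. i < N \<and> f (1 + i) = r}"
        by (intro CollectI exI[of _ "i - 1"]) auto
    qed auto
    moreover have "i < length w \<and> w ! i = r \<longleftrightarrow> i < N \<and> f (1 + i) = r" for i
      unfolding w_def by (auto simp del: upt_Suc)
    ultimately show ?thesis by (simp only: set_positions)
  qed
  have sets: "{i \<in> {1..N}. f i = 1} = set a" "{i \<in> {1..N}. f i = 2} = set b"
      "{i \<in> {1..N}. f i = 3} = set c"
    unfolding un[symmetric] f_def using disj by auto
  have eq: "positions 1 1 w = a" "positions 2 1 w = b" "positions 3 1 w = c"
    using strict_sorted_equal[OF sorted(1) sorted_positions[of 1 1 w]]
      strict_sorted_equal[OF sorted(2) sorted_positions[of 2 1 w]]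
      strict_sorted_equal[OF sorted(3) sorted_positions[of 3 1 w]] sp sets by simp_all
  then have "count_list w 1 = s" "count_list w 2 = s + t" "count_list w 3 = s + t + k"
    using len length_positions[of _ 1 w] by metis+
  moreover have "set w \<subseteq> {1, 2, 3}" unfolding w_def f_def by auto
  ultimately have "w \<in> words (s + t + k) (s + t) s" unfolding words_def by simp
  moreover have "rows w = (a, b, c)" unfolding rows_def eq ..
  ultimately show ?thesis by (metis image_eqI)
qed

lemma bij_betw_rows: "bij_betw rows (words (s + t + k) (s + t) s) (cmlqs s t k)"
proof -
  have "cmlqs s t k \<subseteq> rows ` words (s + t + k) (s + t) s"
    using rows_surj by (metis prod_cases3 subsetI)
  moreover have "rows ` words (s + t + k) (s + t) s \<subseteq> cmlqs s t k"
    using rows_in_cmlqs by (metis image_subsetI)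
  ultimately show ?thesis unfolding bij_betw_def using inj_on_rows by blast
qed

section \<open>The initial letters 2 3 3\<close>

lemma first_two_3_before_2_iff:
  fixes w :: "nat list"
  assumes "set w \<subseteq> {1, 2, 3}" "count_list w 3 \<ge> 2"
  shows "(\<forall>y\<in>set (positions 2 k w). positions 3 k w ! 1 < y) \<longleftrightarrow>
    (\<exists>v. filter (\<lambda>u. u \<noteq> 1) w = 3 # 3 # v)"
  using assms
proof (induction w arbitrary: k)
  case (Cons u w)
  \<comment> \<open>What remains to be shown once the first 3 has been read.\<close>
  have one: "(\<forall>y\<in>set (positions 2 k w). positions 3 k w ! 0 < y) \<longleftrightarrow>
      (\<exists>v. filter (\<lambda>u. u \<noteq> 1) w = 3 # v)"
    if "set w \<subseteq> {1, 2, 3}" "count_list w 3 \<ge> 1" for k and w :: "nat list"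
    using that
  proof (induction w arbitrary: k)
    case (Cons u w)
    have "positions 3 (Suc k) w ! 0 \<in> set (positions 3 (Suc k) w)" if "u \<noteq> 3"
      using Cons.prems that by (intro nth_mem) (auto simp: length_positions)
    then have "\<not> positions 3 (Suc k) w ! 0 < k" if "u \<noteq> 3"
      using that positions_ge[of _ 3 "Suc k" w] by fastforce
    moreover have "\<forall>y\<in>set (positions 2 (Suc k) w). k < y"
      using positions_ge[of _ 2 "Suc k" w] by fastforce
    ultimately show ?case using Cons.IH[of "Suc k"] Cons.prems by auto
  qed simp
  have "positions 3 (Suc k) w ! 1 \<in> set (positions 3 (Suc k) w)" if "u \<noteq> 3"
    using Cons.prems that by (intro nth_mem) (auto simp: length_positions)
  then have "\<not> positions 3 (Suc k) w ! 1 < k" if "u \<noteq> 3"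
    using that positions_ge[of _ 3 "Suc k" w] by fastforce
  then show ?case using Cons.IH[of "Suc k"] Cons.prems one[of w "Suc k"] by auto
qed simp

text \<open>Letters 1 only shift positions, and a leading 3 would precede the first 2. After the
  first 2, the tail must show two letters 3 before the next 2. The bounds on the counts make
  \<open>hd\<close> and the indices 0 and 1 refer to actual entries.\<close>

lemma starts_233_iff:
  fixes w :: "nat list"
  assumes "set w \<subseteq> {1, 2, 3}" "count_list w 2 \<ge> 1" "count_list w 3 \<ge> 2"
  shows "hd (positions 2 k w) < positions 3 k w ! 0 \<and>
      (\<forall>y\<in>set (tl (positions 2 k w)). positions 3 k w ! 1 < y) \<longleftrightarrow>
    (\<exists>v. filter (\<lambda>u. u \<noteq> 1) w = 2 # 3 # 3 # v)"
  using assms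
proof (induction w arbitrary: k)
  case (Cons u w)
  consider "u = 1" | "u = 2" | "u = 3" using Cons.prems by auto
  then show ?case
  proof cases
    case 2
    then have "positions 3 (Suc k) w ! 0 \<in> set (positions 3 (Suc k) w)"
      using Cons.prems by (intro nth_mem) (auto simp: length_positions)
    then have "k < positions 3 (Suc k) w ! 0" using positions_ge[of _ 3 "Suc k" w] by fastforce
    then show ?thesis
      using 2 Cons.prems first_two_3_before_2_iff[of w "Suc k"] by simp
  next
    case 3
    then have "hd (positions 2 (Suc k) w) \<in> set (positions 2 (Suc k) w)"
      using Cons.prems by (intro hd_in_set) (auto simp flip: length_greater_0_conv simp: length_positions)
    then have "\<not> hd (positions 2 (Suc k) w) < k" using positions_ge[of _ 2 "Suc k" w] by fastforce
    then show ?thesis using 3 by simp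
  qed (use Cons in auto)
qed simp

section \<open>Counting ballot words\<close>

text \<open>Read from the end, such a word is a standard Young tableau of shape
  \<open>(p, m, s)\<close>: the letters 3, 2, 1 name its first, second and third row. The prefix
  condition puts the \<open>j\<close> largest entries outside the third row into the first
  row.\<close>

definition ballot_words :: "nat \<Rightarrow> nat \<Rightarrow> nat \<Rightarrow> nat \<Rightarrow> nat list set" where
  "ballot_words j p m s = {w \<in> words p m s. ballot 2 3 w \<and> ballot 1 2 w \<and>
     (\<exists>v. filter (\<lambda>u. u \<noteq> 1) w = replicate j 3 @ v)}"

lemma finite_ballot_words: "finite (ballot_words j p m s)"
  unfolding ballot_words_def using finite_words by simp

lemma ballot_words_Suc_0:
  assumes "m \<le> Suc p"
  shows "ballot_words (Suc j) (Suc p) m 0 = (#) 3 ` ballot_words j p m 0"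
proof (intro set_eqI iffI)
  fix w assume w: "w \<in> ballot_words (Suc j) (Suc p) m 0"
  then obtain u w' where u: "w = u # w'"
    by (cases w) (auto simp: ballot_words_def)
  then show "w \<in> (#) 3 ` ballot_words j p m 0"
    using w by (auto simp: ballot_words_def words_def image_iff split: if_splits)
next
  fix w assume "w \<in> (#) 3 ` ballot_words j p m 0"
  then show "w \<in> ballot_words (Suc j) (Suc p) m 0"
    using assms by (auto simp: ballot_words_def words_def)
qed

text \<open>A positive \<open>j\<close> forbids a 2 in front, which leaves two terms. Iterated, this
  makes the count for \<open>Suc j\<close> a sum over \<open>s\<close> of counts for
  \<open>j\<close>.\<close>

lemma ballot_words_Suc_Suc:
  assumes "m \<le> Suc p" "Suc s \<le> m"
  shows "ballot_words (Suc j) (Suc p) m (Suc s) =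
    (#) 1 ` ballot_words (Suc j) (Suc p) m s \<union> (#) 3 ` ballot_words j p m (Suc s)"
proof (intro set_eqI iffI)
  fix w assume w: "w \<in> ballot_words (Suc j) (Suc p) m (Suc s)"
  then obtain u w' where u: "w = u # w'"
    by (cases w) (auto simp: ballot_words_def)
  then have "u = 1 \<or> u = 3" using w by (auto simp: ballot_words_def words_def split: if_splits)
  then show "w \<in> (#) 1 ` ballot_words (Suc j) (Suc p) m s \<union> (#) 3 ` ballot_words j p m (Suc s)"
    using w u by (auto simp: ballot_words_def words_def image_iff)
next
  fix w assume "w \<in> (#) 1 ` ballot_words (Suc j) (Suc p) m s \<union> (#) 3 ` ballot_words j p m (Suc s)"
  then show "w \<in> ballot_words (Suc j) (Suc p) m (Suc s)"
    using assms by (auto simp: ballot_words_def words_def)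
qed

lemma card_Cons_image: "card ((#) x ` A) = card A"
  by (rule card_image) (auto simp: inj_on_def)

lemma card_ballot_words_Suc_Suc:
  assumes "m \<le> Suc p" "Suc s \<le> m"
  shows "card (ballot_words (Suc j) (Suc p) m (Suc s)) =
    card (ballot_words (Suc j) (Suc p) m s) + card (ballot_words j p m (Suc s))"
  unfolding ballot_words_Suc_Suc[OF assms]
  by (subst card_Un_disjoint) (auto simp: card_Cons_image finite_ballot_words)

text \<open>Removal of the largest entry of the tableau. No corner conditions appear, because the
  sets on the right are empty when the smaller shape is not a partition.\<close>

lemma ballot_words_0_rec:
  assumes "s \<le> m" "m \<le> Suc p"
  shows "ballot_words 0 (Suc p) m s = (#) 3 ` ballot_words 0 p m s \<union>
    ((if m = 0 then {} else (#) 2 ` ballot_words 0 (Suc p) (m - 1) s) \<union>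
    (if s = 0 then {} else (#) 1 ` ballot_words 0 (Suc p) m (s - 1)))" (is "_ = ?R")
proof (intro set_eqI iffI)
  fix w assume w: "w \<in> ballot_words 0 (Suc p) m s"
  then obtain u w' where u: "w = u # w'"
    by (cases w) (auto simp: ballot_words_def words_def)
  then consider "u = 1" | "u = 2" | "u = 3" using w by (auto simp: ballot_words_def words_def)
  then show "w \<in> ?R"
    using w u by cases (auto simp: ballot_words_def words_def image_iff)
next
  fix w assume "w \<in> ?R"
  then show "w \<in> ballot_words 0 (Suc p) m s"
    using assms by (auto simp: ballot_words_def words_def split: if_splits)
qed

lemma card_ballot_words_0_rec:
  assumes "s \<le> m" "m \<le> Suc p"
  shows "card (ballot_words 0 (Suc p) m s) = card (ballot_words 0 p m s) +
    ((if m = 0 then 0 else card (ballot_words 0 (Suc p) (m - 1) s)) +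
    (if s = 0 then 0 else card (ballot_words 0 (Suc p) m (s - 1))))"
proof -
  let ?A = "(#) 3 ` ballot_words 0 p m s"
  let ?B = "if m = 0 then {} else (#) 2 ` ballot_words 0 (Suc p) (m - 1) s"
  let ?C = "if s = 0 then {} else (#) 1 ` ballot_words 0 (Suc p) m (s - 1)"
  have fin: "finite ?A" "finite ?B" "finite ?C" by (simp_all add: finite_ballot_words)
  have "card (?A \<union> (?B \<union> ?C)) = card ?A + (card ?B + card ?C)"
    using fin by (subst card_Un_disjoint; (subst card_Un_disjoint)?) auto
  then show ?thesis
    unfolding ballot_words_0_rec[OF assms] by (simp add: card_Cons_image)
qed

text \<open>The hook length formula for the shape \<open>(p, m, s)\<close>. It vanishes for \<open>s = m + 1\<close> and for
  \<open>m = p + 1\<close>, so the recursion needs no boundary cases.\<close>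

definition hook_num :: "nat \<Rightarrow> nat \<Rightarrow> nat \<Rightarrow> real" where
  "hook_num p m s = fact (p + m + s) * (real p - real m + 1) * (real p - real s + 2) *
     (real m - real s + 1) / (fact (p + 2) * fact (m + 1) * fact s)"

lemma hook_num_0:
  "hook_num p m 0 = (real p + 1 - real m) * fact (p + m) / (fact (p + 1) * fact m)"
proof -
  have f: "(fact (p + 2) :: real) = (real p + 2) * fact (p + 1)"
    "(fact (m + 1) :: real) = (real m + 1) * fact m" by simp_all
  have "real p + 2 \<noteq> 0" "real m + 1 \<noteq> 0" by linarith+
  then show ?thesis unfolding hook_num_def f by (simp del: fact_Suc add: mult_ac add_ac diff_add_eq)
qed

lemma hook_num_rec:
  "hook_num (Suc p) m s = hook_num p m s +
    ((if m = 0 then 0 else hook_num (Suc p) (m - 1) s) +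
    (if s = 0 then 0 else hook_num (Suc p) m (s - 1)))"
  if "s \<le> m"
proof -
  \<comment> \<open>The common factor of all four terms; a polynomial identity is left.\<close>
  define K :: real where "K = fact (p + m + s) / (fact (p + 3) * fact (m + 1) * fact s)"
  have fp: "(fact (p + 3) :: real) = (real p + 3) * fact (p + 2)"
    by (simp add: numeral_3_eq_3 numeral_2_eq_2 add.commute)
  have 0: "hook_num (Suc p) m s = K * ((real p + real m + real s + 1) *
      (real p - real m + 2) * (real p - real s + 3) * (real m - real s + 1))"
  proof -
    have f: "(fact (Suc p + m + s) :: real) = (real p + real m + real s + 1) * fact (p + m + s)"
      by (simp add: algebra_simps)
    have e: "Suc p + 2 = p + 3" "real (Suc p) - real m + 1 = real p - real m + 2"
      "real (Suc p) - real s + 2 = real p - real s + 3" by simp_all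
    show ?thesis unfolding hook_num_def K_def f e by (simp del: fact_Suc)
  qed
  have 1: "hook_num p m s = K * ((real p + 3) *
      (real p - real m + 1) * (real p - real s + 2) * (real m - real s + 1))"
  proof -
    have "real p + 3 \<noteq> 0" by linarith
    then show ?thesis unfolding hook_num_def K_def fp by (simp del: fact_Suc add: mult.assoc)
  qed
  \<comment> \<open>The factor \<open>real m - real s\<close> makes this true at
    \<open>m = 0\<close> as well, where \<open>s = 0\<close>. In the next identity the factor
    \<open>real s\<close> does the same.\<close>
  have 2: "(if m = 0 then 0 else hook_num (Suc p) (m - 1) s) = K * ((real m + 1) *
      (real p - real m + 3) * (real p - real s + 3) * (real m - real s))"
  proof (cases m)
    case 0
    then show ?thesis using that by simp
  next
    case (Suc m')
    have f: "(fact (m + 1) :: real) = (real m + 1) * fact m" by simp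
    have e: "Suc p + m' + s = p + m + s" "Suc p + 2 = p + 3" "m' + 1 = m" using Suc by simp_all
    have r: "real (Suc p) - real m' + 1 = real p - real m + 3"
      "real (Suc p) - real s + 2 = real p - real s + 3" "real m' - real s + 1 = real m - real s"
      using Suc by simp_all
    have "real m + 1 \<noteq> 0" by linarith
    moreover have "(if m = 0 then 0 else hook_num (Suc p) (m - 1) s) = hook_num (Suc p) m' s"
      using Suc by simp
    ultimately show ?thesis unfolding hook_num_def K_def f e r
      by (simp del: fact_Suc add: mult.assoc)
  qed
  have 3: "(if s = 0 then 0 else hook_num (Suc p) m (s - 1)) = K * (real s *
      (real p - real m + 2) * (real p - real s + 4) * (real m - real s + 2))"
  proof (cases s)
    case 0
    then show ?thesis by simp
  next
    case (Suc s')
    have f: "(fact s :: real) = real s * fact s'" using Suc by simp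
    have e: "Suc p + m + s' = p + m + s" "Suc p + 2 = p + 3" using Suc by simp_all
    have r: "real (Suc p) - real m + 1 = real p - real m + 2"
      "real (Suc p) - real s' + 2 = real p - real s + 4" "real m - real s' + 1 = real m - real s + 2"
      using Suc by simp_all
    have "real s \<noteq> 0" using Suc by simp
    moreover have "(if s = 0 then 0 else hook_num (Suc p) m (s - 1)) = hook_num (Suc p) m s'"
      using Suc by simp
    ultimately show ?thesis unfolding hook_num_def K_def f e r
      by (simp del: fact_Suc add: mult.assoc)
  qed
  show ?thesis unfolding 0 1 2 3 by algebra
qed

text \<open>The range includes \<open>s = m + 1\<close> and \<open>m = p + 1\<close>, where both
  sides are 0, because the recursion leads from partitions to these shapes.\<close>

lemma card_ballot_words_0:
  assumes "s \<le> m + 1" "m \<le> p + 1"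
  shows "real (card (ballot_words 0 p m s)) = hook_num p m s"
  using assms
proof (induction "p + m + s" arbitrary: p m s rule: less_induct)
  case less
  have le: "s \<le> m \<and> m \<le> p" if "w \<in> ballot_words 0 p m s" for w
    using that ballot_count_le[of 2 3 w] ballot_count_le[of 1 2 w]
    by (auto simp: ballot_words_def words_def)
  consider "s = m + 1" | "m = p + 1" | "s \<le> m" "m \<le> p" using less.prems by linarith
  then show ?case
  proof cases
    case 1
    then have "ballot_words 0 p m s = {}" using le by auto
    then show ?thesis using 1 by (simp add: hook_num_def)
  next
    case 2
    then have "ballot_words 0 p m s = {}" using le by auto
    then show ?thesis using 2 by (simp add: hook_num_def)
  next
    case 3
    show ?thesis
    proof (cases p)
      case 0
      have "ballot_words 0 0 0 0 = {[]}"
        using length_eq_counts by (fastforce simp: ballot_words_def words_def)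
      then show ?thesis using 0 3 by (simp add: hook_num_def)
    next
      case (Suc p')
      have "real (card (ballot_words 0 p' m s)) = hook_num p' m s"
        using less.hyps[of p' m s] 3 Suc by auto
      moreover have "real (card (ballot_words 0 p (m - 1) s)) = hook_num p (m - 1) s" if "m \<noteq> 0"
        using less.hyps[of p "m - 1" s] 3 that by auto
      moreover have "real (card (ballot_words 0 p m (s - 1))) = hook_num p m (s - 1)" if "s \<noteq> 0"
        using less.hyps[of p m "s - 1"] 3 that by auto
      ultimately show ?thesis
        using card_ballot_words_0_rec[of s m p'] hook_num_rec[of s m p'] 3
        unfolding Suc by auto
    qed
  qed
qed

text \<open>The sum of \<open>hook_num p m i\<close> over \<open>i \<le> s\<close>. With the
  prefactor, the first summand of the bracket is \<open>hook_num p m 0\<close> times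
  \<open>(p + m + s + 1) choose s\<close>, the number of free insertions of \<open>s\<close> letters
  1 into words \<open>3 v\<close>; the second counts those that violate
  \<open>ballot 1 2\<close>.\<close>

lemma card_ballot_words_1:
  assumes "s \<le> m" "m \<le> p"
  shows "real (card (ballot_words 1 (p + 1) m s)) =
    (real p + 1 - real m) / (fact (p + 2) * fact (m + 1)) * fact (p + m + s + 1) / fact s *
    ((real p + 2) * (real m + 1) / (real p + real m + 1) -
     real s * (real p + real m + 4 - real s) / (real p + real m + 3))"
  using assms(1)
proof (induction s)
  case 0
  have "real (card (ballot_words 1 (p + 1) m 0)) = hook_num p m 0"
    using ballot_words_Suc_0[of m p 0] assms card_ballot_words_0[of 0 m p]
    by (simp add: card_Cons_image)
  also have "hook_num p m 0 = (real p + 1 - real m) / (fact (p + 2) * fact (m + 1)) *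
      fact (p + m) * ((real p + 2) * (real m + 1))"
    unfolding hook_num_def by (simp del: fact_Suc add: algebra_simps)
  finally have "real (card (ballot_words 1 (p + 1) m 0)) = \<dots>" .
  moreover have f: "(fact (p + m + 0 + 1) :: real) = (real p + real m + 1) * fact (p + m)" by simp
  moreover have "real p + real m + 1 \<noteq> 0" by linarith
  ultimately show ?case unfolding f by (simp del: fact_Suc)
next
  case (Suc s)
  define E :: real where "E = (real p + 1 - real m) / (fact (p + 2) * fact (m + 1))"
  \<comment> \<open>With \<open>fact (Suc s)\<close> below, both the previous sum and the new hook
    number are multiples of \<open>E * G\<close>, and a rational identity in \<open>p\<close>,
    \<open>m\<close>, \<open>s\<close> remains.\<close>
  define G :: real where "G = fact (p + m + s + 1) / fact (Suc s)"
  have h: "hook_num p m (Suc s) = E * G * ((real p + 1 - real s) * (real m - real s))"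
    unfolding hook_num_def E_def G_def by (simp del: fact_Suc add: algebra_simps)
  have f: "(fact (Suc s) :: real) = (real s + 1) * fact s" by simp
  have i: "real (card (ballot_words 1 (p + 1) m s)) = E * G * (real s + 1) *
     ((real p + 2) * (real m + 1) / (real p + real m + 1) -
     real s * (real p + real m + 4 - real s) / (real p + real m + 3))"
    using Suc unfolding E_def G_def f by (simp del: fact_Suc)
  have "real (card (ballot_words 1 (p + 1) m (Suc s))) =
      real (card (ballot_words 1 (p + 1) m s)) + hook_num p m (Suc s)"
    using card_ballot_words_Suc_Suc[of m p s 0] card_ballot_words_0[of "Suc s" m p] assms Suc.prems
    by simp
  also have "\<dots> = E * G * ((real p + real m + real s + 2) * ((real p + 2) * (real m + 1) / (real p + real m + 1) -
     (real s + 1) * (real p + real m + 3 - real s) / (real p + real m + 3)))"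
  proof -
    have n: "real p + real m + 1 \<noteq> 0" "real p + real m + 3 \<noteq> 0" by linarith+
    have "(real s + 1) * ((real p + 2) * (real m + 1) / (real p + real m + 1) -
       real s * (real p + real m + 4 - real s) / (real p + real m + 3)) +
       (real p + 1 - real s) * (real m - real s) =
      (real p + real m + real s + 2) * ((real p + 2) * (real m + 1) / (real p + real m + 1) -
     (real s + 1) * (real p + real m + 3 - real s) / (real p + real m + 3))"
      using n by (simp add: divide_simps) algebra
    then show ?thesis unfolding i h by (metis (no_types, lifting) distrib_left mult.assoc)
  qed
  also have "\<dots> = (real p + 1 - real m) / (fact (p + 2) * fact (m + 1)) * fact (p + m + Suc s + 1) / fact (Suc s) *
    ((real p + 2) * (real m + 1) / (real p + real m + 1) -
     real (Suc s) * (real p + real m + 4 - real (Suc s)) / (real p + real m + 3))"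
  proof -
    have "(fact (p + m + Suc s + 1) :: real) = (real p + real m + real s + 2) * fact (p + m + s + 1)"
      by (simp add: algebra_simps)
    then show ?thesis unfolding E_def G_def by (simp del: fact_Suc add: mult_ac add_ac)
  qed
  finally show ?case .
qed

text \<open>The second summation, over \<open>card_ballot_words_1\<close>. The first summand again
  counts free insertions, now into \<open>3 3 v\<close>, and will cancel against the free
  count.\<close>

lemma card_ballot_words_2:
  assumes "s \<le> m" "m \<le> p"
  shows "real (card (ballot_words 2 (p + 2) m s)) =
    (real p + 1 - real m) / (fact (p + 2) * fact (m + 1)) * fact (p + m + s + 2) / fact s *
    ((real p + 2) * (real m + 1) / ((real p + real m + 1) * (real p + real m + 2)) -
     real s * (real p + real m + 5 - real s) / ((real p + real m + 3) * (real p + real m + 4)))"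
  using assms(1)
proof (induction s)
  case 0
  have "card (ballot_words 2 (p + 2) m 0) = card (ballot_words 1 (p + 1) m 0)"
    using ballot_words_Suc_0[of m "Suc p" 1] assms
    by (simp add: card_Cons_image numeral_2_eq_2)
  moreover have "(fact (p + m + 0 + 2) :: real) = (real p + real m + 2) * fact (p + m + 0 + 1)" by simp
  moreover have "real p + real m + 1 \<noteq> 0" "real p + real m + 2 \<noteq> 0" by linarith+
  ultimately show ?case using card_ballot_words_1[of 0 m p] assms
    by (simp del: fact_Suc)
next
  case (Suc s)
  define E :: real where "E = (real p + 1 - real m) / (fact (p + 2) * fact (m + 1))"
  define G :: real where "G = fact (p + m + s + 2) / fact (Suc s)"
  have h: "real (card (ballot_words 1 (p + 1) m (Suc s))) = E * G * ((real p + 2) * (real m + 1) / (real p + real m + 1) -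
     (real s + 1) * (real p + real m + 3 - real s) / (real p + real m + 3))"
    using card_ballot_words_1[of "Suc s" m p] assms Suc.prems
    unfolding E_def G_def by (simp del: fact_Suc add: add_ac)
  have f: "(fact (Suc s) :: real) = (real s + 1) * fact s" by simp
  have i: "real (card (ballot_words 2 (p + 2) m s)) = E * G * (real s + 1) *
    ((real p + 2) * (real m + 1) / ((real p + real m + 1) * (real p + real m + 2)) -
     real s * (real p + real m + 5 - real s) / ((real p + real m + 3) * (real p + real m + 4)))"
    using Suc unfolding E_def G_def f by (simp del: fact_Suc)
  have "real (card (ballot_words 2 (p + 2) m (Suc s))) =
      real (card (ballot_words 2 (p + 2) m s)) + real (card (ballot_words 1 (p + 1) m (Suc s)))"
    using card_ballot_words_Suc_Suc[of m "Suc p" s 1] assms Suc.prems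
    by (simp add: numeral_2_eq_2)
  also have "\<dots> = E * G * ((real p + real m + real s + 3) *
    ((real p + 2) * (real m + 1) / ((real p + real m + 1) * (real p + real m + 2)) -
     (real s + 1) * (real p + real m + 4 - real s) / ((real p + real m + 3) * (real p + real m + 4))))"
  proof -
    have n: "real p + real m + 1 \<noteq> 0" "real p + real m + 2 \<noteq> 0"
      "real p + real m + 3 \<noteq> 0" "real p + real m + 4 \<noteq> 0" by linarith+
    have "(real s + 1) *
      ((real p + 2) * (real m + 1) / ((real p + real m + 1) * (real p + real m + 2)) -
     real s * (real p + real m + 5 - real s) / ((real p + real m + 3) * (real p + real m + 4))) +
       ((real p + 2) * (real m + 1) / (real p + real m + 1) -
     (real s + 1) * (real p + real m + 3 - real s) / (real p + real m + 3)) =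
      (real p + real m + real s + 3) *
    ((real p + 2) * (real m + 1) / ((real p + real m + 1) * (real p + real m + 2)) -
     (real s + 1) * (real p + real m + 4 - real s) / ((real p + real m + 3) * (real p + real m + 4)))"
      using n by (simp add: divide_simps) algebra
    then show ?thesis unfolding i h by (metis (no_types, lifting) distrib_left mult.assoc)
  qed
  also have "\<dots> = (real p + 1 - real m) / (fact (p + 2) * fact (m + 1)) * fact (p + m + Suc s + 2) / fact (Suc s) *
    ((real p + 2) * (real m + 1) / ((real p + real m + 1) * (real p + real m + 2)) -
     real (Suc s) * (real p + real m + 5 - real (Suc s)) / ((real p + real m + 3) * (real p + real m + 4)))"
  proof -
    have "(fact (p + m + Suc s + 2) :: real) = (real p + real m + real s + 3) * fact (p + m + s + 2)"
      by (simp add: algebra_simps)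
    then show ?thesis unfolding E_def G_def by (simp del: fact_Suc add: mult_ac add_ac)
  qed
  finally show ?case .
qed

section \<open>Two-row standard Young tableaux\<close>

lemma sorted_max_last:
  fixes u :: "nat list"
  assumes "sorted_wrt (<) u" "N \<in> set u" "\<And>x. x \<in> set u \<Longrightarrow> x \<le> N"
  obtains u' where "u = u' @ [N]"
proof (cases u rule: rev_cases)
  case (snoc u' x)
  then have "x \<le> N" "\<forall>y\<in>set u'. y < x" using assms by (auto simp: sorted_wrt_append)
  then have "N = x" using assms(2) snoc by auto
  then show ?thesis using that snoc by blast
qed (use assms in simp)

lemma syt2_snoc_fst_iff:
  assumes "b \<le> a"
  shows "(u @ [Suc a + b], v) \<in> syt2 (Suc a) b \<longleftrightarrow> (u, v) \<in> syt2 a b"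
proof
  assume L: "(u @ [Suc a + b], v) \<in> syt2 (Suc a) b"
  then have len: "length u = a" and "\<forall>i<b. (u @ [Suc a + b]) ! i < v ! i"
    and "Suc a + b \<notin> set u \<union> set v" and "insert (Suc a + b) (set u \<union> set v) = {1..Suc a + b}"
    by (auto simp: syt2_def)
  then have "\<forall>i<b. u ! i < v ! i" "set u \<union> set v = {1..Suc a + b} - {Suc a + b}"
    using assms by (auto simp: nth_append)
  moreover have "{1..Suc a + b} - {Suc a + b} = {1..a + b}" by auto
  ultimately show "(u, v) \<in> syt2 a b" using L by (auto simp: syt2_def sorted_wrt_append)
next
  assume R: "(u, v) \<in> syt2 a b"
  then have un: "set u \<union> set v = {1..a + b}" and len: "length u = a"
    and uv: "\<forall>i<b. u ! i < v ! i" by (auto simp: syt2_def)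
  have lt: "x < Suc a + b" if "x \<in> set u \<union> set v" for x using that unfolding un by simp
  then have new: "Suc a + b \<notin> set u" "Suc a + b \<notin> set v" "\<forall>x\<in>set u. x < Suc a + b" by blast+
  have "insert (Suc a + b) (set u \<union> set v) = {1..Suc a + b}" unfolding un by auto
  moreover have "\<forall>i<b. (u @ [Suc a + b]) ! i < v ! i"
    using uv len assms by (simp add: nth_append)
  ultimately show "(u @ [Suc a + b], v) \<in> syt2 (Suc a) b"
    using R new by (simp add: syt2_def sorted_wrt_append)
qed

text \<open>With \<open>b < a\<close> the new cell has an entry above it, which is smaller because
  the new entry is the maximum.\<close>

lemma syt2_snoc_snd_iff:
  assumes "b < a"
  shows "(u, v @ [a + Suc b]) \<in> syt2 a (Suc b) \<longleftrightarrow> (u, v) \<in> syt2 a b"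
proof
  assume L: "(u, v @ [a + Suc b]) \<in> syt2 a (Suc b)"
  then have len: "length v = b" and lt: "\<forall>i<Suc b. u ! i < (v @ [a + Suc b]) ! i"
    and un: "a + Suc b \<notin> set u \<union> set v" "insert (a + Suc b) (set u \<union> set v) = {1..a + Suc b}"
    by (auto simp: syt2_def)
  have "\<forall>i<b. u ! i < v ! i" using less_SucI lt len by (metis nth_append)
  moreover have "set u \<union> set v = {1..a + Suc b} - {a + Suc b}" using un by auto
  moreover have "{1..a + Suc b} - {a + Suc b} = {1..a + b}" by auto
  ultimately show "(u, v) \<in> syt2 a b" using L by (auto simp: syt2_def sorted_wrt_append)
next
  assume R: "(u, v) \<in> syt2 a b"
  then have un: "set u \<union> set v = {1..a + b}" and len: "length u = a" "length v = b"
    and uv: "\<forall>i<b. u ! i < v ! i" by (auto simp: syt2_def)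
  have lt: "x < a + Suc b" if "x \<in> set u \<union> set v" for x using that unfolding un by simp
  then have new: "a + Suc b \<notin> set u" "a + Suc b \<notin> set v" "\<forall>x\<in>set v. x < a + Suc b" by blast+
  have "insert (a + Suc b) (set u \<union> set v) = {1..a + Suc b}" unfolding un by auto
  moreover have "\<forall>i<Suc b. u ! i < (v @ [a + Suc b]) ! i"
  proof (intro allI impI)
    fix i assume "i < Suc b"
    then consider "i < b" | "i = b" by linarith
    then show "u ! i < (v @ [a + Suc b]) ! i"
    proof cases
      case 2
      have "u ! b < a + Suc b" using assms len by (intro lt) simp
      then show ?thesis using 2 len by (metis nth_append_length)
    qed (use uv len in \<open>simp add: nth_append\<close>)
  qed
  ultimately show "(u, v @ [a + Suc b]) \<in> syt2 a (Suc b)"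
    using R new by (simp add: syt2_def sorted_wrt_append)
qed

lemma finite_syt2: "finite (syt2 a b)"
proof (rule finite_subset)
  show "syt2 a b \<subseteq> {u. set u \<subseteq> {1..a + b} \<and> length u = a} \<times> {v. set v \<subseteq> {1..a + b} \<and> length v = b}"
    by (auto simp: syt2_def)
qed (intro finite_cartesian_product finite_lists_length_eq finite_atLeastAtMost)

text \<open>The largest entry sits in a corner. For \<open>a = b\<close> the end of the first row is
  none: the entry below it would have to be larger still.\<close>

lemma syt2_max_cases:
  assumes "(u, v) \<in> syt2 a b" "a + b > 0" "b \<le> a"
  obtains u' where "u = u' @ [a + b]" "b < a" | v' where "v = v' @ [a + b]" "0 < b"
proof -
  have s: "sorted_wrt (<) u" "sorted_wrt (<) v" "set u \<union> set v = {1..a + b}"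
      "length u = a" "length v = b" "\<forall>i<b. u ! i < v ! i"
    using assms by (auto simp: syt2_def)
  then have le: "\<And>x. x \<in> set u \<Longrightarrow> x \<le> a + b" "\<And>x. x \<in> set v \<Longrightarrow> x \<le> a + b"
    by auto
  have "a + b \<in> set u \<union> set v" unfolding s(3) using assms(2) by auto
  then consider "a + b \<in> set u" | "a + b \<in> set v" by auto
  then show ?thesis
  proof cases
    case 1
    from sorted_max_last[OF s(1) this le(1)] obtain u' where u: "u = u' @ [a + b]" by auto
    have "b < a"
    proof (rule ccontr)
      assume "\<not> b < a"
      then have ab: "a = b" "b > 0" using assms by auto
      then have "length u' = b - 1" using s(4) u by auto
      then have "u ! (b - 1) = a + b" unfolding u by (metis nth_append_length)
      moreover have "v ! (b - 1) \<le> a + b" using ab s(5) by (intro le(2) nth_mem) auto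
      moreover have "u ! (b - 1) < v ! (b - 1)" using s(6) ab by auto
      ultimately show False by simp
    qed
    then show ?thesis using that u by blast
  next
    case 2
    from sorted_max_last[OF s(2) this le(2)] obtain v' where "v = v' @ [a + b]" by auto
    moreover have "0 < b" using 2 s(5) by (cases v) auto
    ultimately show ?thesis using that by blast
  qed
qed

lemma num_syt2_rec:
  assumes "b \<le> Suc a"
  shows "num_syt2 (Suc a) b = (if b \<le> a then num_syt2 a b else 0) +
    (if b = 0 then 0 else num_syt2 (Suc a) (b - 1))"
proof -
  let ?A = "if b \<le> a then (\<lambda>(u, v). (u @ [Suc a + b], v)) ` syt2 a b else {}"
  let ?B = "if b = 0 then {} else (\<lambda>(u, v). (u, v @ [Suc a + b])) ` syt2 (Suc a) (b - 1)"
  have "syt2 (Suc a) b = ?A \<union> ?B"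
  proof (intro set_eqI iffI)
    fix q assume q: "q \<in> syt2 (Suc a) b"
    obtain u v where uv: "q = (u, v)" by fastforce
    from q have "(u, v) \<in> syt2 (Suc a) b" "Suc a + b > 0" "b \<le> Suc a" using uv assms by auto
    then show "q \<in> ?A \<union> ?B"
    proof (cases rule: syt2_max_cases)
      case (1 u')
      then have "b \<le> a" "(u', v) \<in> syt2 a b"
        using q syt2_snoc_fst_iff[of b a u' v] uv by auto
      then show ?thesis using 1 uv by force
    next
      case (2 v')
      then obtain b' where b': "b = Suc b'" by (cases b) auto
      then have "(u, v') \<in> syt2 (Suc a) b'"
        using q 2 syt2_snoc_snd_iff[of b' "Suc a" u v'] uv assms by auto
      then show ?thesis using 2 uv b' by force
    qed
  next
    fix q assume "q \<in> ?A \<union> ?B"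
    then consider u v where "b \<le> a" "q = (u @ [Suc a + b], v)" "(u, v) \<in> syt2 a b"
      | u v b' where "b = Suc b'" "q = (u, v @ [Suc a + b])" "(u, v) \<in> syt2 (Suc a) b'"
      by (cases b) (auto split: if_splits)
    then show "q \<in> syt2 (Suc a) b"
    proof cases
      case 1
      then show ?thesis using syt2_snoc_fst_iff by blast
    next
      case 2
      then show ?thesis using syt2_snoc_snd_iff[of b' "Suc a"] assms by simp
    qed
  qed
  moreover have "?A \<inter> ?B = {}"
  proof -
    have "Suc (a + b) \<notin> set v" if "(u, v) \<in> syt2 a b" for u v
    proof -
      have "set v \<subseteq> {1..a + b}" using that by (auto simp: syt2_def)
      then show ?thesis by auto
    qed
    then show ?thesis by force
  qed
  moreover have "card ?A = (if b \<le> a then num_syt2 a b else 0)"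
    unfolding num_syt2_def by (auto intro!: card_image simp: inj_on_def)
  moreover have "card ?B = (if b = 0 then 0 else num_syt2 (Suc a) (b - 1))"
    unfolding num_syt2_def by (auto intro!: card_image simp: inj_on_def)
  moreover have "finite ?A" "finite ?B" using finite_syt2 by auto
  ultimately show ?thesis
    unfolding num_syt2_def[of "Suc a" b] by (simp add: card_Un_disjoint)
qed

text \<open>\<open>num_syt2_rec\<close> is \<open>hook_num_rec\<close> at \<open>s = 0\<close>; the
  term it lacks when \<open>b = a' + 1\<close> is a zero of \<open>hook_num\<close>.\<close>

lemma num_syt2_eq_hook_num:
  assumes "b \<le> a"
  shows "real (num_syt2 a b) = hook_num a b 0"
  using assms
proof (induction "a + b" arbitrary: a b rule: less_induct)
  case less
  show ?case
  proof (cases a)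
    case 0
    have "syt2 0 0 = {([], [])}" by (auto simp: syt2_def)
    then show ?thesis using 0 less.prems by (simp add: num_syt2_def hook_num_def)
  next
    case (Suc a')
    have "real (if b \<le> a' then num_syt2 a' b else 0) = hook_num a' b 0"
    proof (cases "b \<le> a'")
      case True
      then show ?thesis using less.hyps[of a' b] Suc by simp
    next
      case False
      then have "b = a' + 1" using less.prems Suc by simp
      then show ?thesis by (simp add: hook_num_def)
    qed
    moreover have "real (num_syt2 a (b - 1)) = hook_num a (b - 1) 0" if "b \<noteq> 0"
      using less.hyps[of a "b - 1"] less.prems that by simp
    ultimately show ?thesis
      using num_syt2_rec[of b a'] hook_num_rec[of 0 b a'] less.prems unfolding Suc
      by (cases "b = 0") (simp_all del: of_nat_add add: of_nat_add)
  qed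
qed

section \<open>Counting the queues\<close>

lemma alpha13_eq_card_words:
  assumes "s \<ge> 1" "t \<ge> 1" "n > s + t"
  shows "alpha13 s t n = card {w \<in> words n (s + t) s. last w = 3 \<and> ballot 2 3 w \<and>
    (\<exists>v. filter (\<lambda>u. u \<noteq> 1) w = 2 # 3 # 3 # v) \<and> \<not> (\<exists>w'. w = 2 # w' \<and> ballot 1 2 w')}"
proof -
  define k where "k = n - s - t"
  have k: "n = s + t + k" "k \<ge> 1" using assms by (auto simp: k_def)
  define P where "P q \<longleftrightarrow> n + 2 * s + t \<in> set (last_row q) \<and> no_wrapping_23 q \<and>
     projected_word q ! 0 = 1 \<and> projected_word q ! 1 = 3" for q
  have "bij_betw rows {w \<in> words n (s + t) s. P (rows w)} {q \<in> cmlqs s t k. P q}"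
    using bij_betw_rows[of s t k] unfolding k(1) by (rule bij_betw_Collect) simp
  from bij_betw_same_card[OF this]
  have "alpha13 s t n = card {w \<in> words n (s + t) s. P (rows w)}"
    unfolding alpha13_def P_def k_def by simp
  moreover have "P (rows w) \<longleftrightarrow> last w = 3 \<and> ballot 2 3 w \<and>
      (\<exists>v. filter (\<lambda>u. u \<noteq> 1) w = 2 # 3 # 3 # v) \<and> \<not> (\<exists>w'. w = 2 # w' \<and> ballot 1 2 w')"
    if w: "w \<in> words n (s + t) s" for w
  proof -
    have cw: "set w \<subseteq> {1, 2, 3}" "count_list w 3 = n" "count_list w 2 = s + t" "count_list w 1 = s"
      using w by (auto simp: words_def)
    have len: "length w = n + 2 * s + t" using length_eq_counts[OF cw(1)] cw by simp
    then have "w \<noteq> []" using assms by auto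
    have lastN: "n + 2 * s + t \<in> set (positions 3 1 w) \<longleftrightarrow> last w = 3"
      unfolding set_positions last_conv_nth[OF \<open>w \<noteq> []\<close>] len[symmetric]
    proof
      assume "length w \<in> {1 + i | i. i < length w \<and> w ! i = 3}"
      then show "w ! (length w - 1) = 3" by auto
    next
      assume "w ! (length w - 1) = 3"
      then show "length w \<in> {1 + i | i. i < length w \<and> w ! i = 3}"
        using \<open>w \<noteq> []\<close> by (intro CollectI exI[of _ "length w - 1"]) auto
    qed
    have "rows w \<in> cmlqs s t k" using rows_in_cmlqs[of w s t k] w k by simp
    note cond = cmlq_conditions_iff[OF this[unfolded rows_def] assms(1,2) k(2)]
    \<comment> \<open>A leading 1 makes both sides false, since an entry of row 1 then precedes row
      2. With a leading 2, \<open>hd\<close> of row 2 is the entry 1, and the tail of row 2 is read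
      off the rest of the word.\<close>
    have unmatched: "(\<forall>x\<in>set (positions 1 1 w). hd (positions 2 1 w) < x) \<and>
        dominated (positions 1 1 w) (set (tl (positions 2 1 w))) \<longleftrightarrow>
        (\<exists>w'. w = 2 # w' \<and> ballot 1 2 w')"
      if v: "filter (\<lambda>u. u \<noteq> 1) w = 2 # 3 # 3 # v" for v
    proof -
      obtain u w' where u: "w = u # w'" using \<open>w \<noteq> []\<close> by (cases w) auto
      then have "u = 1 \<or> u = 2" using v by (auto split: if_splits)
      then show ?thesis
      proof
        assume 1: "u = 1"
        have "hd (positions 2 2 w') \<in> set (positions 2 2 w')"
          using 1 u cw(3) assms(1)
          by (intro hd_in_set) (auto simp flip: length_greater_0_conv simp: length_positions)
        then have "hd (positions 2 2 w') \<ge> 2" by (rule positions_ge)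
        then show ?thesis using 1 u by (auto simp: numeral_2_eq_2)
      next
        assume 2: "u = 2"
        have "\<forall>x\<in>set (positions 1 2 w'). 1 < x" using positions_ge[of _ 1 2 w'] by fastforce
        then show ?thesis
          using 2 u dominated_positions[of 1 2 w' 2] by (simp add: numeral_2_eq_2)
      qed
    qed
    have P: "P (rows w) \<longleftrightarrow> last w = 3 \<and> ballot 2 3 w \<and>
        (hd (positions 2 1 w) < positions 3 1 w ! 0 \<and>
         (\<forall>y\<in>set (tl (positions 2 1 w)). positions 3 1 w ! 1 < y)) \<and>
        \<not> ((\<forall>x\<in>set (positions 1 1 w). hd (positions 2 1 w) < x) \<and>
           dominated (positions 1 1 w) (set (tl (positions 2 1 w))))"
      by (simp only: P_def rows_def last_row.simps cond lastN dominated_positions conj_assoc)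
    have "count_list w 2 \<ge> 1" "count_list w 3 \<ge> 2" using cw assms by auto
    note st = starts_233_iff[OF cw(1) this]
    show ?thesis
    proof (cases "\<exists>v. filter (\<lambda>u. u \<noteq> 1) w = 2 # 3 # 3 # v")
      case True
      then show ?thesis unfolding P st using unmatched by blast
    next
      case False
      then show ?thesis unfolding P st by blast
    qed
  qed
  ultimately show ?thesis by (simp only: cong: conj_cong)
qed

text \<open>The last letter belongs to \<open>u\<close> and is split off. What precedes it is an
  arbitrary shuffle of the letters \<open>x\<close> with \<open>butlast u\<close>, and shuffles of
  disjoint lists are counted by a binomial coefficient.\<close>

lemma card_insert_letter:
  assumes "u \<noteq> []" "x \<notin> set u"
  shows "card {w. filter (\<lambda>y. y \<noteq> x) w = u \<and> count_list w x = s \<and> last w \<noteq> x} =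
    (s + length u - 1) choose s"
proof -
  let ?S = "shuffles (replicate s x) (butlast u)"
  have "{w. filter (\<lambda>y. y \<noteq> x) w = u \<and> count_list w x = s \<and> last w \<noteq> x} =
      (\<lambda>w. w @ [last u]) ` ?S"
  proof (intro set_eqI iffI)
    fix w assume w: "w \<in> {w. filter (\<lambda>y. y \<noteq> x) w = u \<and> count_list w x = s \<and> last w \<noteq> x}"
    then obtain w0 z where z: "w = w0 @ [z]" using assms(1) by (cases w rule: rev_cases) auto
    then have u: "u = filter (\<lambda>y. y \<noteq> x) w0 @ [z]" and c: "count_list w0 x = s" using w by auto
    have "filter (\<lambda>y. y = x) w0 = replicate s x"
      unfolding c[symmetric] by (induction w0) auto
    then have "w0 \<in> ?S" using partition_in_shuffles[of w0 "\<lambda>y. y = x"] u by simp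
    then show "w \<in> (\<lambda>w. w @ [last u]) ` ?S" using u z by auto
  next
    fix w assume "w \<in> (\<lambda>w. w @ [last u]) ` ?S"
    then obtain w0 where w0: "w = w0 @ [last u]" "w0 \<in> ?S" by auto
    have d: "set (replicate s x) \<inter> set (butlast u) = {}"
      using assms(2) by (auto dest: in_set_butlastD)
    have fl: "filter (\<lambda>y. y \<in> set (replicate s x)) w0 = replicate s x"
      "filter (\<lambda>y. y \<notin> set (replicate s x)) w0 = butlast u"
      using filter_shuffles_disjoint1[OF d w0(2)] by auto
    have mem: "y = x \<longleftrightarrow> y \<in> set (replicate s x)" if "y \<in> set w0" for y
      using that set_shuffles[OF w0(2)] assms(2) by (auto dest: in_set_butlastD)
    have "filter (\<lambda>y. y = x) w0 = filter (\<lambda>y. y \<in> set (replicate s x)) w0"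
      "filter (\<lambda>y. y \<noteq> x) w0 = filter (\<lambda>y. y \<notin> set (replicate s x)) w0"
      by (rule filter_cong[OF refl], use mem in blast)+
    then have "filter (\<lambda>y. y = x) w0 = replicate s x" "filter (\<lambda>y. y \<noteq> x) w0 = butlast u"
      unfolding fl by blast+
    moreover have "count_list w0 x = length (filter (\<lambda>y. y = x) w0)"
      by (induction w0) auto
    moreover have "last u \<noteq> x" using assms last_in_set by metis
    ultimately show "w \<in> {w. filter (\<lambda>y. y \<noteq> x) w = u \<and> count_list w x = s \<and> last w \<noteq> x}"
      using w0(1) assms(1) by simp
  qed
  then have "card {w. filter (\<lambda>y. y \<noteq> x) w = u \<and> count_list w x = s \<and> last w \<noteq> x} = card ?S"
    by (simp add: card_image inj_on_def)
  also have "\<dots> = (length (replicate s x) + length (butlast u)) choose length (replicate s x)"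
    using assms(2) by (intro card_disjoint_shuffles) (auto dest: in_set_butlastD)
  finally show ?thesis using assms(1) by (simp add: Suc_leI)
qed

lemma ballot_last:
  assumes "ballot 2 3 w" "w \<noteq> []"
  shows "last w \<noteq> (2 :: nat)"
  using assms by (induction w) (auto split: if_splits)

text \<open>The words are grouped by \<open>v\<close>. Two letters 3 outweigh one 2, so the ballot
  condition is one on \<open>v\<close> alone. It excludes a final 2, so ending in 3 means not ending
  in 1. Of the \<open>n + m + 3\<close> letters of \<open>2 3 3 v\<close> the last is fixed, hence
  the upper index.\<close>

lemma card_words_starting_233:
  "card {w \<in> words (n + 2) (m + 1) s. last w = 3 \<and> ballot 2 3 w \<and>
    (\<exists>v. filter (\<lambda>u. u \<noteq> 1) w = 2 # 3 # 3 # v)} =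
    card (ballot_words 0 n m 0) * ((n + m + s + 2) choose s)" (is "card ?A = _")
proof -
  let ?V = "ballot_words 0 n m 0"
  let ?W = "\<lambda>v. {w. filter (\<lambda>y. y \<noteq> 1) w = 2 # 3 # 3 # v \<and> count_list w 1 = s \<and> last w \<noteq> (1::nat)}"
  have V: "v \<in> ?V \<longleftrightarrow> set v \<subseteq> {2, 3} \<and> count_list v 3 = n \<and> count_list v 2 = m \<and> ballot 2 3 v" for v
    by (auto simp: ballot_words_def words_def count_list_0_iff intro: ballot_notin)
  have A: "?A = (\<Union>v\<in>?V. ?W v)"
  proof (intro set_eqI iffI)
    fix w assume w: "w \<in> ?A"
    then obtain v where v: "filter (\<lambda>u. u \<noteq> 1) w = 2 # 3 # 3 # v" by auto
    have "set (2 # 3 # 3 # v) \<subseteq> {2, 3}"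
      unfolding v[symmetric] using w by (auto simp: words_def)
    moreover have "count_list (2 # 3 # 3 # v) 3 = n + 2" "count_list (2 # 3 # 3 # v) 2 = m + 1"
      unfolding v[symmetric] using w by (simp_all add: count_filter_neq words_def)
    moreover have "ballot 2 3 (2 # 3 # 3 # v)"
      unfolding v[symmetric] using w by (simp add: ballot_filter)
    ultimately have "v \<in> ?V" unfolding V by auto
    then show "w \<in> (\<Union>v\<in>?V. ?W v)" using w v by (auto simp: words_def)
  next
    fix w assume "w \<in> (\<Union>v\<in>?V. ?W v)"
    then obtain v where v: "v \<in> ?V" "w \<in> ?W v" by auto
    then have f: "filter (\<lambda>u. u \<noteq> 1) w = 2 # 3 # 3 # v" by simp
    have c: "count_list w 3 = n + 2" "count_list w 2 = m + 1"
      using count_filter_neq[of 3 1 w] count_filter_neq[of 2 1 w] v(1) unfolding f V by auto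
    have "set w \<subseteq> insert 1 (set (filter (\<lambda>u. u \<noteq> 1) w))" by auto
    then have sw: "set w \<subseteq> {1, 2, 3}" using v(1) unfolding f V by auto
    have "ballot 2 3 (2 # 3 # 3 # v)" using v(1) ballot_count_le[of 2 3 v] unfolding V by auto
    then have b: "ballot 2 3 w" unfolding f[symmetric] by (simp add: ballot_filter)
    have "w \<noteq> []" using f by auto
    then have "last w = 3" using ballot_last[OF b] v(2) sw last_in_set by fastforce
    then show "w \<in> ?A" using sw c b f v(2) by (auto simp: words_def)
  qed
  have U: "card (\<Union>v\<in>?V. ?W v) = (\<Sum>v\<in>?V. card (?W v))"
  proof (rule card_UN_disjoint)
    show "\<forall>v\<in>?V. finite (?W v)"
    proof
      fix v assume "v \<in> ?V"
      have "?W v \<subseteq> {w. set w \<subseteq> set (1 # 2 # 3 # v) \<and> length w = s + length (2 # 3 # 3 # v)}"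
      proof
        fix w assume w: "w \<in> ?W v"
        have "length w = count_list w 1 + length (filter (\<lambda>y. y \<noteq> 1) w)" by (induction w) auto
        moreover have "set w \<subseteq> insert 1 (set (filter (\<lambda>u. u \<noteq> 1) w))" by auto
        moreover have "filter (\<lambda>u. u \<noteq> 1) w = 2 # 3 # 3 # v" "count_list w 1 = s" using w by auto
        ultimately show "w \<in> {w. set w \<subseteq> set (1 # 2 # 3 # v) \<and> length w = s + length (2 # 3 # 3 # v)}"
          by (simp only: mem_Collect_eq) auto
      qed
      then show "finite (?W v)" by (rule finite_subset) (intro finite_lists_length_eq finite_set)
    qed
  qed (use finite_ballot_words in auto)
  have "(\<Sum>v\<in>?V. card (?W v)) = (\<Sum>v\<in>?V. (n + m + s + 2) choose s)"
  proof (rule sum.cong)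
    fix v assume v: "v \<in> ?V"
    then have "length v = n + m" using length_eq_counts[of v] unfolding ballot_words_def words_def by auto
    moreover have "1 \<notin> set (2 # 3 # 3 # v)" using v unfolding V by auto
    ultimately show "card (?W v) = (n + m + s + 2) choose s"
      using card_insert_letter[of "2 # 3 # 3 # v" 1 s] by (simp add: add_ac)
  qed simp
  then show ?thesis unfolding A U by simp
qed

text \<open>Subtracted are the words whose initial 2 is not bullied from row 1. Without this 2 they
  have \<open>s + t - 1\<close> letters 2 and start with \<open>3 3\<close> up to letters 1, hence
  \<open>j = 2\<close>.\<close>

lemma alpha13_eq_difference:
  assumes "s \<ge> 1" "t \<ge> 1" "n \<ge> s + t - 1"
  shows "int (alpha13 s t (n + 2)) = int (card (ballot_words 0 n (s + t - 1) 0) * ((n + t + 2 * s + 1) choose s))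
    - int (card (ballot_words 2 (n + 2) (s + t - 1) s))"
proof -
  define m where "m = s + t - 1"
  have m: "s + t = m + 1" "s \<le> m" "m \<le> n" using assms by (auto simp: m_def)
  let ?A = "{w \<in> words (n + 2) (m + 1) s. last w = 3 \<and> ballot 2 3 w \<and>
    (\<exists>v. filter (\<lambda>u. u \<noteq> 1) w = 2 # 3 # 3 # v)}"
  let ?B = "(#) 2 ` ballot_words 2 (n + 2) m s"
  have "?B \<subseteq> ?A"
  proof
    fix w assume "w \<in> ?B"
    then obtain w' where w': "w = 2 # w'" "w' \<in> ballot_words 2 (n + 2) m s" by auto
    then have b: "ballot 2 3 w'" "ballot 1 2 w'" and c: "w' \<in> words (n + 2) m s"
      by (auto simp: ballot_words_def)
    have "w' \<noteq> []" using c by (auto simp: words_def)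
    \<comment> \<open>The suffix of length one violates a ballot condition if it is 1 or 2, so
      membership in \<open>?B\<close> already forces a final 3.\<close>
    moreover have "last w' \<noteq> 1"
      using b(2) \<open>w' \<noteq> []\<close> by (induction w') (auto split: if_splits)
    moreover have "set w' \<subseteq> {1, 2, 3}" using c by (simp add: words_def)
    ultimately have "last w' = 3" using ballot_last[OF b(1)] last_in_set[of w'] by blast
    moreover obtain v where "filter (\<lambda>u. u \<noteq> 1) w' = replicate 2 3 @ v"
      using w'(2) by (auto simp: ballot_words_def)
    ultimately show "w \<in> ?A" using w'(1) b c m(3) \<open>w' \<noteq> []\<close>
      by (auto simp: words_def numeral_2_eq_2)
  qed
  have "alpha13 s t (n + 2) = card (?A - ?B)"
  proof -
    have "s + t < n + 2" using m by simp
    have "{w \<in> words (n + 2) (s + t) s. last w = 3 \<and> ballot 2 3 w \<and>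
        (\<exists>v. filter (\<lambda>u. u \<noteq> 1) w = 2 # 3 # 3 # v) \<and>
        \<not> (\<exists>w'. w = 2 # w' \<and> ballot 1 2 w')} = ?A - ?B"
      unfolding m(1) by (auto simp: ballot_words_def words_def numeral_2_eq_2)
    then show ?thesis using alpha13_eq_card_words[OF assms(1,2) \<open>s + t < n + 2\<close>] by simp
  qed
  moreover have "int (card (?A - ?B)) = int (card ?A) - int (card ?B)"
    using \<open>?B \<subseteq> ?A\<close> finite_words[of "n + 2" "m + 1" s]
    by (subst card_Diff_subset) (auto intro: finite_subset card_mono of_nat_diff simp: finite_ballot_words)
  ultimately have "int (alpha13 s t (n + 2)) = int (card ?A) - int (card ?B)" by (simp only:)
  moreover have "n + m + s + 2 = n + t + 2 * s + 1" using m(1) by simp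
  ultimately show ?thesis
    by (simp only: m_def[symmetric] card_Cons_image card_words_starting_233)
qed

text \<open>The second coefficient is \<open>r (r - 1) / ((L + 1) (L + 2))\<close> times the first,
  and \<open>(L + 1) (L + 2) - r (r - 1) = (L + r + 1) (L + 2 - r)\<close>. For \<open>r < 2\<close>
  the second coefficient is 0.\<close>

lemma binom_diff:
  "real_of_int (binom (L + r) (int r) - binom (L + r) (int r - 2)) =
    fact (L + r + 1) * (real L + 2 - real r) / (fact r * fact (L + 2))"
proof -
  consider "r = 0" | "r = 1" | q where "r = q + 2"
    by (metis One_nat_def add_2_eq_Suc' not0_implies_Suc)
  then show ?thesis
  proof cases
    case 1
    have "(fact (L + 2) :: real) = (real L + 2) * fact (L + 1)" by simp
    then show ?thesis using 1 by (simp add: binom_def del: fact_Suc)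
  next
    case 2
    then show ?thesis by (simp add: binom_def nat_diff_distrib del: fact_Suc)
  next
    case (3 q)
    have "q \<le> L + r" "L + r - q = L + 2" using 3 by simp_all
    then have c: "real ((L + r) choose r) = fact (L + r) / (fact r * fact L)"
      "real ((L + r) choose q) = fact (L + r) / (fact q * fact (L + 2))"
      using binomial_fact[of r "L + r", where 'a = real]
        binomial_fact[of q "L + r", where 'a = real] by (simp_all del: fact_Suc)
    have f: "(fact (L + r + 1) :: real) = (real L + real r + 1) * fact (L + r)"
      "(fact (L + 2) :: real) = (real L + 2) * (real L + 1) * fact L"
      "(fact r :: real) = (real q + 2) * (real q + 1) * fact q"
      using 3 by (simp_all add: algebra_simps)
    have n: "real L + 2 \<noteq> 0" "real L + 1 \<noteq> 0" "real q + 2 \<noteq> 0" "real q + 1 \<noteq> 0" by linarith+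
    have "real_of_int (binom (L + r) (int r) - binom (L + r) (int r - 2)) =
        real ((L + r) choose r) - real ((L + r) choose q)"
    proof -
      have "int r - 2 = int q" using 3 by simp
      then show ?thesis by (simp add: binom_def)
    qed
    also have "\<dots> = fact (L + r + 1) * (real L + 2 - real r) / (fact r * fact (L + 2))"
    proof -
      define F :: real where "F = fact (L + r)"
      have r: "real r = real q + 2" using 3 by simp
      show ?thesis unfolding c f F_def[symmetric] r using n by (simp add: divide_simps) algebra
    qed
    finally show ?thesis .
  qed
qed

theorem theorem5p2:
  fixes s t n N :: nat
  assumes "s \<ge> 1" and "t \<ge> 1" and "n > s + t" and "N = n + 2 * s + t"
  shows "int (alpha13 s t n) =
    (binom (N - 2) (int s - 1) - binom (N - 2) (int s - 3)) * int (num_syt2 (n - 1) (s + t))"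
proof -
  \<comment> \<open>\<open>p\<close> and \<open>m\<close> count the letters 3 and 2 of
    \<open>v\<close> in \<open>2 3 3 v\<close>.\<close>
  define p where "p = n - 2"
  define m where "m = s + t - 1"
  have n: "n = p + 2" and st: "s + t = m + 1" and sm: "s \<le> m" and mp: "m \<le> p"
    using assms by (auto simp: p_def m_def)
  \<comment> \<open>\<open>E\<close> is the tableau number of the theorem divided by
    \<open>fact (p + m + 2)\<close>, as \<open>syt\<close> shows; both counts contain it as a
    factor.\<close>
  define E :: real where "E = (real p + 1 - real m) / (fact (p + 2) * fact (m + 1))"
  define G :: real where "G = fact (p + m + s + 2) / fact s"
  have nz: "real p + 2 \<noteq> 0" "real m + 1 \<noteq> 0" "real p + real m + 1 \<noteq> 0" "real p + real m + 2 \<noteq> 0"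
    "real p + real m + 3 \<noteq> 0" "real p + real m + 4 \<noteq> 0" by linarith+
  have all: "real (card (ballot_words 0 p m 0) * ((p + m + s + 2) choose s)) =
      E * G * ((real p + 2) * (real m + 1) / ((real p + real m + 1) * (real p + real m + 2)))"
  proof -
    have "real (card (ballot_words 0 p m 0)) = E * (real p + 2) * (real m + 1) * fact (p + m)"
    proof -
      have f: "(fact (p + 2) :: real) = (real p + 2) * fact (p + 1)"
        "(fact (m + 1) :: real) = (real m + 1) * fact m" by simp_all
      show ?thesis unfolding E_def f
        using card_ballot_words_0[of 0 m p] mp nz by (simp add: hook_num_0 del: fact_Suc)
    qed
    moreover have "real ((p + m + s + 2) choose s) = fact (p + m + s + 2) / (fact s * fact (p + m + 2))"
      by (simp add: binomial_fact del: fact_Suc)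
    moreover have "(fact (p + m + 2) :: real) = (real p + real m + 2) * (real p + real m + 1) * fact (p + m)"
      by (simp add: algebra_simps)
    ultimately show ?thesis unfolding G_def using nz by (simp del: fact_Suc add: mult_ac)
  qed
  have bad: "real (card (ballot_words 2 (p + 2) m s)) =
      E * G * ((real p + 2) * (real m + 1) / ((real p + real m + 1) * (real p + real m + 2)) -
       real s * (real p + real m + 5 - real s) / ((real p + real m + 3) * (real p + real m + 4)))"
    using card_ballot_words_2[OF sm mp] unfolding E_def G_def by simp
  have syt: "real (num_syt2 (p + 1) (m + 1)) = E * fact (p + m + 2)"
    using num_syt2_eq_hook_num[of "m + 1" "p + 1"] mp unfolding hook_num_0 E_def
    by (simp del: fact_Suc)
  have bin: "real_of_int (binom (N - 2) (int s - 1) - binom (N - 2) (int s - 3)) =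
      G * (real s * (real p + real m + 5 - real s)) /
      (fact (p + m + 2) * (real p + real m + 3) * (real p + real m + 4))"
  proof -
    \<comment> \<open>\<open>binom_diff\<close> is used with \<open>L = p + m + 2\<close>; its
      factor \<open>L + 2 - r\<close> is the \<open>p + m + 5 - s\<close> of
      \<open>bad\<close>.\<close>
    define r where "r = s - 1"
    have s: "s = Suc r" using assms(1) by (simp add: r_def)
    have N: "N - 2 = (p + m + 2) + r" using assms(4) n st s by simp
    have i: "int s - 1 = int r" "int s - 3 = int r - 2" using s by simp_all
    have f: "(fact (p + m + 2 + 2) :: real) =
        (real p + real m + 4) * (real p + real m + 3) * fact (p + m + 2)"
      by (simp add: algebra_simps)
    have g: "(fact s :: real) = real s * fact r" and h: "p + m + 2 + r + 1 = p + m + s + 2"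
      using s by simp_all
    have "real s \<noteq> 0" using s by simp
    then show ?thesis unfolding N i binom_diff f h G_def g
      using nz s by (simp del: fact_Suc add: mult_ac add_ac)
  qed
  have "real_of_int (int (alpha13 s t n)) =
      E * G * (real s * (real p + real m + 5 - real s) / ((real p + real m + 3) * (real p + real m + 4)))"
  proof -
    have e: "p + t + 2 * s + 1 = p + m + s + 2" using st by simp
    have "int (alpha13 s t n) = int (card (ballot_words 0 p m 0) * ((p + m + s + 2) choose s)) -
        int (card (ballot_words 2 (p + 2) m s))"
      unfolding n using alpha13_eq_difference[OF assms(1,2), of p, folded m_def, OF mp] unfolding e .
    then have "real_of_int (int (alpha13 s t n)) =
        real (card (ballot_words 0 p m 0) * ((p + m + s + 2) choose s)) -
        real (card (ballot_words 2 (p + 2) m s))" by simp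
    \<comment> \<open>The first summand of \<open>bad\<close> equals \<open>all\<close>, so only the
      violating insertions survive.\<close>
    then show ?thesis unfolding all bad by (simp only: right_diff_distrib)
  qed
  also have "\<dots> = real_of_int (binom (N - 2) (int s - 1) - binom (N - 2) (int s - 3)) *
      real (num_syt2 (p + 1) (m + 1))"
    unfolding bin syt using nz by (simp del: fact_Suc)
  finally have "real_of_int (int (alpha13 s t n)) = real_of_int
      ((binom (N - 2) (int s - 1) - binom (N - 2) (int s - 3)) * int (num_syt2 (n - 1) (s + t)))"
    using n st by simp
  then show ?thesis by (simp only: of_int_eq_iff)
qed

end
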